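(* Let $\mathbb{V}$ be an $n$-dimensional vector space over a field $\mathbb{F}$. Suppose $\mathbb{F}$ has the property that there are only finitely many extensions of $\mathbb{F}$ of degree at most $n$. Then there are finitely many $z$-classes of the $GL(\mathbb{V})$-action on $L(\mathbb{V})$, and finitely many $z$-classes of the $GA(\mathbb{V})$-action on $A(\mathbb{V})$.
   Context: $L(\mathbb{V})$ is the set of linear maps $\mathbb{V}\to\mathbb{V}$ and $GL(\mathbb{V})$ the group of invertible ones; $A(\mathbb{V})$ is the set of affine maps $x\mapsto Ax+v$ ($A\in L(\mathbb{V})$, $v\in\mathbb{V}$) and $GA(\mathbb{V})$ the group of invertible ones. The actions are by conjugation $T\mapsto fTf^{-1}$. Two elements of $L(\mathbb{V})$ (resp. $A(\mathbb{V})$) are $z$-equivalent if their centralizers in $GL(\mathbb{V})$ (resp. $GA(\mathbb{V})$) are conjugate subgroups of $GL(\mathbb{V})$ (resp. $GA(\mathbb{V})$); a $z$-class is an equivalence class of this relation. Field extensions are counted up to $\mathbb{F}$-isomorphism. *)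

theory Defs
  imports "HOL-Algebra.Algebra" "HOL-Algebra.Algebraic_Closure_Type" "HOL-Algebra.Group_Action"
begin

section \<open>Field extensions of a field given by a type\<close>

definition field_extension :: "('k, 'm) ring_scheme \<Rightarrow> ('a::field \<Rightarrow> 'k) \<Rightarrow> bool" where
  "field_extension L \<phi> \<longleftrightarrow> field L \<and> \<phi> \<in> ring_hom ring_of_type_algebra L"

definition extension_degree_le :: "('k, 'm) ring_scheme \<Rightarrow> ('a::field \<Rightarrow> 'k) \<Rightarrow> nat \<Rightarrow> bool" where
  "extension_degree_le L \<phi> n \<longleftrightarrow> (\<exists>d\<le>n. ring.dimension L d (range \<phi>) (carrier L))"

definition extension_iso ::
    "('k, 'm) ring_scheme \<Rightarrow> ('a::field \<Rightarrow> 'k) \<Rightarrow> ('l, 'o) ring_scheme \<Rightarrow> ('a \<Rightarrow> 'l) \<Rightarrow> bool" where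
  "extension_iso L \<phi> L' \<phi>' \<longleftrightarrow> (\<exists>h\<in>ring_iso L L'. \<forall>a. h (\<phi> a) = \<phi>' a)"

text \<open>
  One cannot quantify over all types, so extensions are represented with carriers inside
  \<open>'a list\<close>. By \<open>extension_representable\<close> below, every extension of finite degree,
  whatever its carrier type, is isomorphic over \<open>'a\<close> to one of these, so no extension is missed.
\<close>

definition extensions_le :: "nat \<Rightarrow> ('a list ring \<times> ('a::field \<Rightarrow> 'a list)) set" where
  "extensions_le n = {(L, \<phi>). field_extension L \<phi> \<and> extension_degree_le L \<phi> n}"

definition extension_iso_rel ::
    "nat \<Rightarrow> (('a list ring \<times> ('a::field \<Rightarrow> 'a list)) \<times> ('a list ring \<times> ('a \<Rightarrow> 'a list))) set" where
  "extension_iso_rel n =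
     {((L, \<phi>), (L', \<phi>')). (L, \<phi>) \<in> extensions_le n \<and> (L', \<phi>') \<in> extensions_le n
        \<and> extension_iso L \<phi> L' \<phi>'}"

definition finitely_many_extensions_le :: "'a::field itself \<Rightarrow> nat \<Rightarrow> bool" where
  "finitely_many_extensions_le _ n \<longleftrightarrow>
     finite ((extensions_le n :: ('a list ring \<times> ('a \<Rightarrow> 'a list)) set) // extension_iso_rel n)"

lemma extension_iso_refl: "extension_iso L \<phi> L \<phi>"
  unfolding extension_iso_def by (rule bexI[of _ id]) (auto simp: ring_iso_def ring_hom_def)

lemma extension_iso_sym:
  assumes "field_extension L \<phi>" "field_extension L' \<phi>'" "extension_iso L \<phi> L' \<phi>'"
  shows "extension_iso L' \<phi>' L \<phi>"
proof -
  obtain h where h: "h \<in> ring_iso L L'" "\<And>a. h (\<phi> a) = \<phi>' a"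
    using assms(3) by (auto simp: extension_iso_def)
  have r: "ring L" using assms(1) by (simp add: field_extension_def field_def domain_def cring_def)
  have c: "\<phi> a \<in> carrier L" for a
    using assms(1) by (auto simp: field_extension_def ring_hom_def ring_of_type_algebra_def)
  have inj: "inj_on h (carrier L)" using h(1) by (auto simp: ring_iso_def bij_betw_def)
  have "inv_into (carrier L) h (\<phi>' a) = \<phi> a" for a
    unfolding h(2)[symmetric] by (rule inv_into_f_f[OF inj c])
  moreover have "inv_into (carrier L) h \<in> ring_iso L' L" by (rule ring_iso_set_sym[OF r h(1)])
  ultimately show ?thesis by (auto simp: extension_iso_def)
qed

lemma extension_iso_trans:
  assumes "extension_iso L \<phi> L' \<phi>'" "extension_iso L' \<phi>' L'' \<phi>''"
  shows "extension_iso L \<phi> L'' \<phi>''"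
proof -
  obtain h where h: "h \<in> ring_iso L L'" "\<And>a. h (\<phi> a) = \<phi>' a"
    using assms(1) by (auto simp: extension_iso_def)
  obtain k where k: "k \<in> ring_iso L' L''" "\<And>a. k (\<phi>' a) = \<phi>'' a"
    using assms(2) by (auto simp: extension_iso_def)
  show ?thesis unfolding extension_iso_def
    by (rule bexI[of _ "k \<circ> h"]) (use ring_iso_set_trans[OF h(1) k(1)] in \<open>auto simp: h(2) k(2)\<close>)
qed

lemma equiv_extension_iso_rel: "equiv (extensions_le n) (extension_iso_rel n)"
proof (rule equivI)
  show "extension_iso_rel n \<subseteq> extensions_le n \<times> extensions_le n"
    by (auto simp: extension_iso_rel_def)
  show "refl_on (extensions_le n) (extension_iso_rel n)"
    by (auto simp: refl_on_def extension_iso_rel_def extension_iso_refl)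
  show "sym (extension_iso_rel n)"
    unfolding sym_def extension_iso_rel_def extensions_le_def
    using extension_iso_sym by blast
  show "trans (extension_iso_rel n)"
    unfolding trans_def extension_iso_rel_def using extension_iso_trans by blast
qed

lemma extension_representable:
  fixes L :: "'k ring" and \<phi> :: "'a::field \<Rightarrow> 'k"
  assumes ext: "field_extension L \<phi>" and deg: "extension_degree_le L \<phi> n"
  shows "\<exists>(L', \<phi>') \<in> extensions_le n. extension_iso L \<phi> L' \<phi>'"
proof -
  interpret L: field L using ext by (simp add: field_extension_def)
  have hom: "\<phi> \<in> ring_hom ring_of_type_algebra L" using ext by (simp add: field_extension_def)
  interpret F: field "ring_of_type_algebra :: 'a ring" by (rule field_from_type_algebra)
  interpret \<phi>: ring_hom_ring "ring_of_type_algebra :: 'a ring" L \<phi>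
    by (rule ring_hom_ringI2[OF F.ring_axioms L.ring_axioms hom])
  have carF: "carrier (ring_of_type_algebra :: 'a ring) = UNIV"
    by (simp add: ring_of_type_algebra_def)
  have sub: "subfield (range \<phi>) L"
    using \<phi>.img_is_subfield(2)[OF F.carrier_is_subfield] carF by simp
  obtain d where d: "d \<le> n" "L.dimension d (range \<phi>) (carrier L)"
    using deg by (auto simp: extension_degree_le_def)
  obtain Us where Us: "L.independent (range \<phi>) Us" "L.Span (range \<phi>) Us = carrier L"
    using L.exists_base[OF sub d(2)] by blast
  have "\<exists>Ks. x = L.combine (map \<phi> Ks) Us" if "x \<in> carrier L" for x
  proof -
    have x: "x \<in> L.Span (range \<phi>) Us" using that unfolding Us(2) .
    obtain Ks where Ks: "set Ks \<subseteq> range \<phi>" "x = L.combine Ks Us"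
      using L.unique_decomposition[OF sub Us(1) x, THEN ex1_implies_ex] by blast
    have "Ks = map \<phi> (map (inv_into UNIV \<phi>) Ks)"
      using Ks(1) by (auto simp: f_inv_into_f subset_iff intro!: map_idI[symmetric])
    then show ?thesis using Ks(2) by metis
  qed
  then have "\<forall>x\<in>carrier L. \<exists>Ks. x = L.combine (map \<phi> Ks) Us" by blast
  from bchoice[OF this] obtain c
    where c: "\<And>x. x \<in> carrier L \<Longrightarrow> x = L.combine (map \<phi> (c x)) Us" by blast
  have inj: "inj_on c (carrier L)"
  proof (rule inj_onI)
    fix x y assume xy: "x \<in> carrier L" "y \<in> carrier L" "c x = c y"
    show "x = y" by (rule trans[OF c[OF xy(1)] c[OF xy(2), symmetric, folded xy(3)]])
  qed
  let ?L' = "image_ring c L"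
  have iso: "c \<in> ring_iso L ?L'" by (rule inj_imp_image_ring_iso[OF inj])
  have fld: "field ?L'" by (rule L.inj_imp_image_ring_is_field[OF inj])
  interpret L': field ?L' by (rule fld)
  have c_hom: "c \<in> ring_hom L ?L'" using iso by (simp add: ring_iso_def)
  interpret c: ring_hom_ring L ?L' c
    by (rule ring_hom_ringI2[OF L.ring_axioms L'.ring_axioms c_hom])
  have "L'.dimension d (c ` range \<phi>) (c ` carrier L)"
    by (rule c.inj_hom_dimension[OF sub L'.one_not_zero inj d(2)])
  then have "extension_degree_le ?L' (c \<circ> \<phi>) n"
    using d(1) by (auto simp: extension_degree_le_def image_ring_carrier image_comp)
  moreover have "field_extension ?L' (c \<circ> \<phi>)"
    using fld ring_hom_trans[OF hom c_hom] by (simp add: field_extension_def)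
  moreover have "extension_iso L \<phi> ?L' (c \<circ> \<phi>)"
    using iso by (auto simp: extension_iso_def)
  ultimately show ?thesis by (auto simp: extensions_le_def)
qed

section \<open>z-classes\<close>

text \<open>The group of units of a monoid acting on the monoid by conjugation.\<close>

definition centralizer :: "('b, 'm) monoid_scheme \<Rightarrow> 'b \<Rightarrow> 'b set" where
  "centralizer M T = stabilizer (units_of M) (\<lambda>f S. f \<otimes>\<^bsub>M\<^esub> S \<otimes>\<^bsub>M\<^esub> inv\<^bsub>M\<^esub> f) T"

definition conjugate_subsets :: "('b, 'm) monoid_scheme \<Rightarrow> 'b set \<Rightarrow> 'b set \<Rightarrow> bool" where
  "conjugate_subsets G H K \<longleftrightarrow> (\<exists>g\<in>carrier G. K = g <#\<^bsub>G\<^esub> (H #>\<^bsub>G\<^esub> inv\<^bsub>G\<^esub> g))"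

definition z_equiv_rel :: "('b, 'm) monoid_scheme \<Rightarrow> ('b \<times> 'b) set" where
  "z_equiv_rel M = {(S, T). S \<in> carrier M \<and> T \<in> carrier M \<and>
     conjugate_subsets (units_of M) (centralizer M S) (centralizer M T)}"

definition z_classes :: "('b, 'm) monoid_scheme \<Rightarrow> 'b set set" where
  "z_classes M = carrier M // z_equiv_rel M"

lemma (in monoid) mem_centralizer_iff:
  assumes "T \<in> carrier G"
  shows "f \<in> centralizer G T \<longleftrightarrow> f \<in> Units G \<and> f \<otimes> T = T \<otimes> f"
proof -
  have "f \<otimes> T \<otimes> inv f = T \<longleftrightarrow> f \<otimes> T = T \<otimes> f" if f: "f \<in> Units G"
  proof -
    have "f \<otimes> T \<otimes> inv f \<otimes> f = f \<otimes> T" "T \<otimes> f \<otimes> inv f = T"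
      using f assms by (simp_all add: m_assoc Units_closed)
    then show ?thesis by metis
  qed
  then show ?thesis by (auto simp: centralizer_def stabilizer_def units_of_carrier)
qed

lemma (in monoid) centralizer_subgroup:
  assumes "T \<in> carrier G"
  shows "subgroup (centralizer G T) (units_of G)"
proof -
  interpret U: group "units_of G" by (rule units_group)
  show ?thesis
  proof (rule U.subgroupI)
    show "centralizer G T \<subseteq> carrier (units_of G)"
      by (auto simp: mem_centralizer_iff assms units_of_carrier)
    have "\<one> \<in> centralizer G T" by (simp add: mem_centralizer_iff assms)
    then show "centralizer G T \<noteq> {}" by blast
  next
    fix f assume f: "f \<in> centralizer G T"
    then have u: "f \<in> Units G" and e: "f \<otimes> T = T \<otimes> f" by (auto simp: mem_centralizer_iff assms)
    have "inv f \<otimes> T = inv f \<otimes> (T \<otimes> f) \<otimes> inv f"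
      using u assms by (simp add: m_assoc Units_closed)
    also have "\<dots> = T \<otimes> inv f"
      unfolding e[symmetric] using u assms by (simp add: m_assoc[symmetric] Units_closed)
    finally show "inv\<^bsub>units_of G\<^esub> f \<in> centralizer G T"
      using u by (simp add: units_of_inv mem_centralizer_iff assms)
  next
    fix f g assume "f \<in> centralizer G T" "g \<in> centralizer G T"
    then have u: "f \<in> Units G" "g \<in> Units G" and e: "f \<otimes> T = T \<otimes> f" "g \<otimes> T = T \<otimes> g"
      by (auto simp: mem_centralizer_iff assms)
    have "f \<otimes> g \<otimes> T = T \<otimes> (f \<otimes> g)"
      using u e assms by (metis Units_closed m_assoc)
    then show "f \<otimes>\<^bsub>units_of G\<^esub> g \<in> centralizer G T"
      using u by (simp add: mem_centralizer_iff assms units_of_mult)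
  qed
qed

lemma (in group) conjugate_subsets_equiv:
  shows "H \<subseteq> carrier G \<Longrightarrow> conjugate_subsets G H H"
    and "H \<subseteq> carrier G \<Longrightarrow> conjugate_subsets G H K \<Longrightarrow> conjugate_subsets G K H"
    and "H \<subseteq> carrier G \<Longrightarrow> conjugate_subsets G H K \<Longrightarrow> conjugate_subsets G K J
      \<Longrightarrow> conjugate_subsets G H J"
proof -
  have img: "g <# (H #> inv g) = (\<lambda>h. g \<otimes> h \<otimes> inv g) ` H"
    if "H \<subseteq> carrier G" "g \<in> carrier G" for H g
    using that by (force simp: l_coset_def r_coset_def m_assoc)
  have cl: "(\<lambda>h. g \<otimes> h \<otimes> inv g) ` H \<subseteq> carrier G"
    if "H \<subseteq> carrier G" "g \<in> carrier G" for H g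
    using that by auto
  have comp: "(\<lambda>h. a \<otimes> h \<otimes> inv a) ` (\<lambda>h. b \<otimes> h \<otimes> inv b) ` H
      = (\<lambda>h. (a \<otimes> b) \<otimes> h \<otimes> inv (a \<otimes> b)) ` H"
    if "H \<subseteq> carrier G" "a \<in> carrier G" "b \<in> carrier G" for H a b
    unfolding image_image
    by (rule image_cong) (use that in \<open>auto simp: inv_mult_group m_assoc subset_iff\<close>)
  have one: "(\<lambda>h. \<one> \<otimes> h \<otimes> inv \<one>) ` H = H" if "H \<subseteq> carrier G" for H
    using that by (force simp: subset_iff)
  show "conjugate_subsets G H H" if H: "H \<subseteq> carrier G"
    unfolding conjugate_subsets_def by (rule bexI[of _ \<one>]) (simp_all only: img[OF H] one[OF H] one_closed)
  show "conjugate_subsets G K H" if H: "H \<subseteq> carrier G" and c: "conjugate_subsets G H K"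
  proof -
    obtain g where g: "g \<in> carrier G" "K = (\<lambda>h. g \<otimes> h \<otimes> inv g) ` H"
      using c img[OF H] by (auto simp: conjugate_subsets_def)
    have K: "K \<subseteq> carrier G" using cl[OF H g(1)] g(2) by simp
    have "inv g <# (K #> inv (inv g)) = H"
      unfolding img[OF K inv_closed[OF g(1)]] unfolding g(2) comp[OF H inv_closed[OF g(1)] g(1)]
      using one[OF H] g(1) by simp
    then show ?thesis using g(1) unfolding conjugate_subsets_def by (metis inv_closed)
  qed
  show "conjugate_subsets G H J"
    if H: "H \<subseteq> carrier G" and c: "conjugate_subsets G H K" "conjugate_subsets G K J"
  proof -
    obtain g where g: "g \<in> carrier G" "K = (\<lambda>h. g \<otimes> h \<otimes> inv g) ` H"
      using c(1) img[OF H] by (auto simp: conjugate_subsets_def)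
    have K: "K \<subseteq> carrier G" using cl[OF H g(1)] g(2) by simp
    obtain k where k: "k \<in> carrier G" "J = (\<lambda>h. k \<otimes> h \<otimes> inv k) ` K"
      using c(2) img[OF K] by (auto simp: conjugate_subsets_def)
    have "J = (k \<otimes> g) <# (H #> inv (k \<otimes> g))"
      unfolding img[OF H m_closed[OF k(1) g(1)]] unfolding k(2) g(2) comp[OF H k(1) g(1)] ..
    then show ?thesis using g k unfolding conjugate_subsets_def by blast
  qed
qed

lemma (in monoid) equiv_z_equiv_rel: "equiv (carrier G) (z_equiv_rel G)"
proof -
  interpret U: group "units_of G" by (rule units_group)
  have s: "centralizer G T \<subseteq> carrier (units_of G)" if "T \<in> carrier G" for T
    using subgroup.subset[OF centralizer_subgroup[OF that]] .
  show ?thesis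
  proof (rule equivI)
    show "z_equiv_rel G \<subseteq> carrier G \<times> carrier G" by (auto simp: z_equiv_rel_def)
    show "refl_on (carrier G) (z_equiv_rel G)"
      unfolding refl_on_def z_equiv_rel_def using U.conjugate_subsets_equiv(1)[OF s] by blast
    show "sym (z_equiv_rel G)"
      unfolding sym_def z_equiv_rel_def using U.conjugate_subsets_equiv(2)[OF s] by blast
    show "trans (z_equiv_rel G)"
      unfolding trans_def z_equiv_rel_def using U.conjugate_subsets_equiv(3)[OF s] by blast
  qed
qed

section \<open>Linear and affine maps\<close>

text \<open>
  The unit groups of these two composition monoids are the general linear group and the
  general affine group.
\<close>

definition linear_monoid :: "('a::field \<Rightarrow> 'v::ab_group_add \<Rightarrow> 'v) \<Rightarrow> ('v \<Rightarrow> 'v) monoid" where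
  "linear_monoid scale =
     \<lparr>carrier = {A. Vector_Spaces.linear scale scale A}, monoid.mult = (\<circ>), one = id\<rparr>"

definition affine_monoid :: "('a::field \<Rightarrow> 'v::ab_group_add \<Rightarrow> 'v) \<Rightarrow> ('v \<Rightarrow> 'v) monoid" where
  "affine_monoid scale =
     \<lparr>carrier = {\<lambda>x. A x + v |A v. Vector_Spaces.linear scale scale A}, monoid.mult = (\<circ>), one = id\<rparr>"

context vector_space
begin

lemma linear_inv:
  assumes "Vector_Spaces.linear scale scale A" "bij A"
  shows "Vector_Spaces.linear scale scale (inv_into UNIV A)"
proof -
  interpret p: vector_space_pair scale scale ..
  obtain g where "Vector_Spaces.linear scale scale g" "g \<circ> A = id"
    using p.linear_injective_left_inverse[OF assms(1)] assms(2) by (auto simp: bij_def)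
  moreover from this have "g = inv_into UNIV A"
    using assms(2) by (metis bij_is_surj comp_assoc comp_id id_comp surj_iff)
  ultimately show ?thesis by simp
qed

lemma monoid_linear_monoid: "monoid (linear_monoid scale)"
  by unfold_locales
    (auto simp: linear_monoid_def linear_id Vector_Spaces.linear_compose comp_assoc)

lemma Units_linear_monoid:
  "Units (linear_monoid scale) = {A. Vector_Spaces.linear scale scale A \<and> bij A}"
proof -
  have "\<exists>B. Vector_Spaces.linear scale scale B \<and> B \<circ> A = id \<and> A \<circ> B = id"
    if "Vector_Spaces.linear scale scale A" "bij A" for A
    using linear_inv[OF that] inv_o_cancel[OF bij_is_inj[OF that(2)]]
      bij_is_surj[OF that(2), unfolded surj_iff] by blast
  then show ?thesis by (auto simp: Units_def linear_monoid_def intro: o_bij)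
qed

lemma affine_monoid_memI:
  "Vector_Spaces.linear scale scale A \<Longrightarrow> (\<lambda>x. A x + v) \<in> carrier (affine_monoid scale)"
  by (auto simp: affine_monoid_def)

lemma monoid_affine_monoid: "monoid (affine_monoid scale)"
proof
  fix f g assume "f \<in> carrier (affine_monoid scale)" "g \<in> carrier (affine_monoid scale)"
  then obtain A v B w where fg: "f = (\<lambda>x. A x + v)" "g = (\<lambda>x. B x + w)"
    and AB: "Vector_Spaces.linear scale scale A" "Vector_Spaces.linear scale scale B"
    by (auto simp: affine_monoid_def)
  interpret A: Vector_Spaces.linear scale scale A by (rule AB(1))
  have "f \<circ> g = (\<lambda>x. (A \<circ> B) x + (A w + v))" by (auto simp: fg A.add add.assoc)
  moreover have "Vector_Spaces.linear scale scale (A \<circ> B)" by (rule Vector_Spaces.linear_compose[OF AB(2,1)])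
  ultimately have "f \<circ> g \<in> carrier (affine_monoid scale)"
    by (simp only: affine_monoid_memI)
  then show "f \<otimes>\<^bsub>affine_monoid scale\<^esub> g \<in> carrier (affine_monoid scale)"
    by (simp add: affine_monoid_def)
next
  have "\<one>\<^bsub>affine_monoid scale\<^esub> = (\<lambda>x. id x + (0::'b))"
    by (auto simp: affine_monoid_def)
  then show "\<one>\<^bsub>affine_monoid scale\<^esub> \<in> carrier (affine_monoid scale)"
    by (simp only: affine_monoid_memI[OF linear_id])
qed (auto simp: affine_monoid_def)

lemma Units_affine_monoid:
  "Units (affine_monoid scale) =
     {\<lambda>x. A x + v |A v. Vector_Spaces.linear scale scale A \<and> bij A}"
proof (intro equalityI subsetI)
  fix f assume f: "f \<in> Units (affine_monoid scale)"
  then obtain A v where A: "f = (\<lambda>x. A x + v)" "Vector_Spaces.linear scale scale A"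
    by (auto simp: Units_def affine_monoid_def)
  have "bij f" using f by (auto simp: Units_def affine_monoid_def intro: o_bij)
  moreover have "A = (\<lambda>x. x - v) \<circ> f" by (auto simp: A(1))
  moreover have "bij (\<lambda>x. x - v)"
    by (rule o_bij[of "\<lambda>x. x + v"]) auto
  ultimately have "bij A" by (simp add: bij_comp)
  then show "f \<in> {\<lambda>x. A x + v |A v. Vector_Spaces.linear scale scale A \<and> bij A}"
    using A by blast
next
  fix f assume "f \<in> {\<lambda>x. A x + v |A v. Vector_Spaces.linear scale scale A \<and> bij A}"
  then obtain A v where A: "f = (\<lambda>x. A x + v)" "Vector_Spaces.linear scale scale A" "bij A"
    by auto
  let ?B = "inv_into UNIV A"
  have B: "Vector_Spaces.linear scale scale ?B" by (rule linear_inv[OF A(2,3)])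
  interpret B: Vector_Spaces.linear scale scale ?B by (rule B)
  have AB: "A (?B x) = x" "?B (A x) = x" for x
    using A(3) by (simp_all add: bij_is_surj surj_f_inv_f bij_is_inj)
  let ?g = "\<lambda>x. ?B x + - ?B v"
  have "f \<circ> ?g = id" "?g \<circ> f = id"
    using AB by (auto simp: A(1) B.add fun_eq_iff B.diff[symmetric])
  moreover have "?g \<in> carrier (affine_monoid scale)" "f \<in> carrier (affine_monoid scale)"
  proof -
    show "?g \<in> carrier (affine_monoid scale)" by (rule affine_monoid_memI[OF B])
    show "f \<in> carrier (affine_monoid scale)" unfolding A(1) by (rule affine_monoid_memI[OF A(2)])
  qed
  ultimately show "f \<in> Units (affine_monoid scale)"
    unfolding Units_def by (auto simp: affine_monoid_def)
qed

end

end

theory Submission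
  imports Defs
begin

text \<open>
  A linear map \<open>T\<close> makes the space a module over the polynomials, and its centralizer consists of
  the automorphisms of that module. The centralizer depends only on the algebra of
  polynomials in \<open>T\<close>, so two maps are z-equivalent as soon as one is similar to a
  generator \<open>g(T)\<close> of the algebra of the other. The proof finds a finite invariant that
  forces this.

  The module is a direct sum of cyclic modules, the \<open>i\<close>-th being isomorphic to the polynomials
  modulo \<open>p i ^ k i\<close> with \<open>p i\<close> monic irreducible (\<open>exists_primary_presentation\<close>), and a map is determined up
  to similarity by these data (\<open>presents_same_imp_similar\<close>). The essential point is that, as far as the algebra
  is concerned, \<open>p i\<close> matters only through its residue field, together with the information
  whether it is separable: if \<open>p\<close> and \<open>q\<close> have isomorphic residue fields
  and are both separable or both inseparable, then some substitution \<open>g\<close> for the variable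
  carries \<open>q\<close> to a polynomial divisible by \<open>p\<close> exactly once (\<open>residue_iso_lifts_to\<close>). Such a
  \<open>g\<close> identifies the polynomials modulo \<open>q ^ k\<close> with those modulo \<open>p ^ k\<close> for every \<open>k\<close>
  (\<open>lifts_to_power_dvd_iff\<close>, \<open>lifts_to_inverse\<close>); over a perfect field this
  amounts to both being truncated polynomial rings over the common residue field, but the argument covers
  imperfect fields as well. The Chinese remainder theorem merges the substitutions for
  the different irreducible factors into one \<open>g\<close> (\<open>exists_matching_generator\<close>), and
  \<open>g(T)\<close> has a cyclic decomposition on the same generators as \<open>T\<close>, with every \<open>p i\<close> replaced by the
  \<open>q i\<close> that belongs to the other map.
  Residue fields of the \<open>p i\<close> have degree at most the dimension of the space, so
  they fall into finitely many classes by hypothesis; exponents and number of summands are bounded too.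

  An affine map is, after a translation of the origin, \<open>\<lambda>x. T x + u\<close> where \<open>u\<close> is zero or
  one of the cyclic generators belonging to the polynomial \<open>X - 1\<close> (\<open>exists_normal_form\<close>), because
  only the class of \<open>u\<close> modulo the image of \<open>T - 1\<close> matters. Recording which generator it is
  adds finitely many possibilities, and if \<open>g\<close> agrees with \<open>X\<close> to high order at \<open>1\<close>, then
  passing from \<open>T\<close> to \<open>g(T)\<close> does not change which affine maps commute with \<open>\<lambda>x. T x + u\<close>
  (\<open>commutes_polynomial\<close>).
\<close>

hide_const (open) Divisibility.irreducible

section \<open>Polynomials over a field modulo powers of irreducibles\<close>

lemma dvd_diff_trans:
  fixes a b c d :: "'a::comm_ring_1"
  assumes "d dvd a - b" "d dvd b - c"
  shows "d dvd a - c"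
  using dvd_add[OF assms] by simp

lemma dvd_diff_imp_dvd_iff:
  fixes a b d :: "'a::comm_ring_1"
  assumes "d dvd a - b"
  shows "d dvd a \<longleftrightarrow> d dvd b"
  using dvd_add[OF assms, of b] dvd_diff[OF _ assms, of a] by auto

text \<open>
  A nonzero combination of \<open>f\<close> and \<open>p\<close> of least degree divides both, hence is a unit.
\<close>

lemma irreducible_bezout:
  fixes p f :: "'a::field poly"
  assumes p: "irreducible p" and nd: "\<not> p dvd f"
  shows "\<exists>a b. a * f + b * p = 1"
proof -
  define I where "I = {a * f + b * p | a b. a * f + b * p \<noteq> 0}"
  have "0 * f + 1 * p \<noteq> 0" using p by (auto simp: Factorial_Ring.irreducible_def)
  then have "0 * f + 1 * p \<in> I" unfolding I_def by blast
  then obtain d where d: "d \<in> I" and dmin: "\<And>e. e \<in> I \<Longrightarrow> degree d \<le> degree e"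
    using arg_min_nat_lemma[of "\<lambda>d. d \<in> I" _ degree] by metis
  obtain a b where ab: "d = a * f + b * p" "d \<noteq> 0" using d unfolding I_def by blast
  have dvd: "d dvd g" if g: "g = u * f + v * p" for g u v
  proof (rule ccontr)
    assume "\<not> d dvd g"
    then have nz: "g mod d \<noteq> 0" by (simp add: dvd_eq_mod_eq_0)
    have "g mod d = g - (g div d) * d" by (simp add: minus_div_mult_eq_mod)
    also have "\<dots> = (u - g div d * a) * f + (v - g div d * b) * p"
      unfolding ab(1) by (subst (1) g) (simp add: algebra_simps)
    finally have "g mod d \<in> I" using nz unfolding I_def mem_Collect_eq by metis
    from dmin[OF this] show False
      using degree_mod_less[OF ab(2), of g] nz by simp
  qed
  have df: "d dvd f" by (rule dvd[of _ 1 0]) simp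
  have "d dvd p" by (rule dvd[of _ 0 1]) simp
  then have "is_unit d" using p nd df Factorial_Ring.irreducibleD' dvd_trans by metis
  then obtain c where "1 = d * c" unfolding dvd_def by blast
  then have "c * a * f + c * b * p = 1" by (simp add: ab(1) algebra_simps)
  then show ?thesis by blast
qed

lemma irreducible_bezout_power:
  fixes p f :: "'a::field poly"
  assumes p: "irreducible p" and nd: "\<not> p dvd f"
  shows "\<exists>a b. a * f + b * p ^ k = 1"
proof (induction k)
  case 0
  have "0 * f + 1 * p ^ 0 = 1" by simp
  then show ?case by blast
next
  case (Suc k)
  then obtain a b where ab: "a * f + b * p ^ k = 1" by blast
  obtain c d where cd: "c * f + d * p = 1" using irreducible_bezout[OF p nd] by blast
  have "(a * f + b * p ^ k) * (c * f + d * p) = 1" by (simp add: ab cd)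
  then have "(a * (c * f + d * p) + b * p ^ k * c) * f + (b * d) * p ^ Suc k = 1"
    by (simp add: algebra_simps)
  then show ?case by blast
qed

lemma irreducible_dvd_mult:
  fixes p :: "'a::field poly"
  assumes "irreducible p"
  shows "p dvd a * b \<longleftrightarrow> p dvd a \<or> p dvd b"
  using field_poly_irreducible_imp_prime[OF assms] by (rule prime_elem_dvd_mult_iff)

lemma irreducible_dvd_power:
  fixes p :: "'a::field poly"
  assumes "irreducible p" "p dvd a ^ k"
  shows "p dvd a"
  using field_poly_irreducible_imp_prime[OF assms(1)] assms(2) by (rule prime_elem_dvd_power)

lemma irreducible_dvd_prod:
  fixes p :: "'a::field poly"
  assumes "irreducible p" "finite A" "p dvd prod f A"
  shows "\<exists>x\<in>A. p dvd f x"
  using assms(2,3) by induction (use assms(1) in \<open>auto simp: irreducible_dvd_mult Factorial_Ring.irreducible_def\<close>)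

lemma irreducible_degree_pos:
  fixes p :: "'a::field poly"
  assumes "irreducible p" shows "degree p > 0"
  using assms by (metis gr0I Factorial_Ring.irreducible_def is_unit_iff_degree)

lemma monic_irreducible_dvd_imp_eq:
  fixes p q :: "'a::field poly"
  assumes p: "irreducible p" "lead_coeff p = 1" and q: "irreducible q" "lead_coeff q = 1"
    and "p dvd q"
  shows "p = q"
proof -
  obtain c where c: "q = p * c" using assms by blast
  have "is_unit c" using q(1) c p(1) unfolding Factorial_Ring.irreducible_def by metis
  then obtain a where a: "c = [:a:]" by (metis is_unit_poly_iff)
  have "a = 1" using q(2) p(2) unfolding c a lead_coeff_mult by simp
  then show ?thesis using c a by simp
qed

lemma exists_monic_irreducible_dvd:
  fixes f :: "'a::field poly"
  assumes "degree f > 0"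
  shows "\<exists>p. irreducible p \<and> lead_coeff p = 1 \<and> p dvd f"
  using assms
proof (induction "degree f" arbitrary: f rule: less_induct)
  case less
  show ?case
  proof (cases "irreducible f")
    case True
    let ?c = "inverse (lead_coeff f)"
    have c: "?c \<noteq> 0" using less.prems by auto
    have "irreducible (smult ?c f)"
    proof (rule Factorial_Ring.irreducibleI)
      show "smult ?c f \<noteq> 0" using less.prems by auto
      show "\<not> is_unit (smult ?c f)"
        using True c by (simp add: Factorial_Ring.irreducible_def smult_dvd_iff is_unit_smult_iff)
      fix a b assume "smult ?c f = a * b"
      then have "f = smult (lead_coeff f) a * b"
        using c by (metis inverse_zero mult_smult_left right_inverse smult_1_left smult_smult)
      then have "is_unit (smult (lead_coeff f) a) \<or> is_unit b" using True by (metis Factorial_Ring.irreducible_def)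
      then show "is_unit a \<or> is_unit b" by (auto simp: is_unit_smult_iff)
    qed
    moreover have "lead_coeff (smult ?c f) = 1" using c by simp
    moreover have "smult ?c f dvd f" using c by (simp add: smult_dvd)
    ultimately show ?thesis by blast
  next
    case False
    have "f \<noteq> 0" "\<not> is_unit f" using less.prems by (auto simp: is_unit_poly_iff)
    then obtain a b where ab: "f = a * b" "\<not> is_unit a" "\<not> is_unit b"
      using False unfolding Factorial_Ring.irreducible_def by blast
    then have nz: "a \<noteq> 0" "b \<noteq> 0" using \<open>f \<noteq> 0\<close> by auto
    then have "degree a > 0" "degree b > 0" using ab by (auto simp: is_unit_iff_degree)
    then have "degree a < degree f" using nz ab by (simp add: degree_mult_eq)
    from less.hyps[OF this \<open>degree a > 0\<close>] show ?thesis using ab(1) dvd_mult2 by blast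
  qed
qed

lemma split_off_power:
  fixes p f :: "'a::field poly"
  assumes f: "f \<noteq> 0" and p: "degree p > 0"
  shows "\<exists>e c. f = p ^ e * c \<and> \<not> p dvd c"
  using f
proof (induction "degree f" arbitrary: f rule: less_induct)
  case less
  show ?case
  proof (cases "p dvd f")
    case True
    then obtain g where g: "f = p * g" by blast
    then have "g \<noteq> 0" "p \<noteq> 0" using less.prems by auto
    then have "degree g < degree f" using p g by (simp add: degree_mult_eq)
    then obtain e c where "g = p ^ e * c" "\<not> p dvd c" using less.hyps \<open>g \<noteq> 0\<close> by blast
    then have "f = p ^ Suc e * c" "\<not> p dvd c" using g by simp_all
    then show ?thesis by blast
  next
    case False
    then have "f = p ^ 0 * f \<and> \<not> p dvd f" by simp
    then show ?thesis by blast
  qed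
qed

lemma dvd_pcompose_diff:
  fixes f g h :: "'a::field poly"
  shows "g - h dvd f \<circ>\<^sub>p g - f \<circ>\<^sub>p h"
proof (induction f)
  case (pCons a f)
  have "pCons a f \<circ>\<^sub>p g - pCons a f \<circ>\<^sub>p h = g * (f \<circ>\<^sub>p g - f \<circ>\<^sub>p h) + (g - h) * (f \<circ>\<^sub>p h)"
    by (simp add: pcompose_pCons algebra_simps)
  then show ?case using pCons.IH by (simp add: dvd_add)
qed simp

lemma pcompose_power: "(f ^ k) \<circ>\<^sub>p g = (f \<circ>\<^sub>p g) ^ k" for f g :: "'a::field poly"
  by (induction k) (simp_all add: pcompose_1 pcompose_mult)

lemma pcompose_dvd: "f dvd g \<Longrightarrow> f \<circ>\<^sub>p h dvd g \<circ>\<^sub>p h" for f g h :: "'a::field poly"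
  by (auto simp: dvd_def pcompose_mult)

lemma pcompose_X [simp]: "[:0, 1:] \<circ>\<^sub>p f = f" for f :: "'a::field poly"
  by (simp add: pcompose_pCons)

lemma pcompose_taylor:
  fixes f g d :: "'a::field poly"
  shows "d\<^sup>2 dvd f \<circ>\<^sub>p (g + d) - (f \<circ>\<^sub>p g + d * (pderiv f \<circ>\<^sub>p g))"
proof (induction f)
  case (pCons a f)
  have "pCons a f \<circ>\<^sub>p (g + d) - (pCons a f \<circ>\<^sub>p g + d * (pderiv (pCons a f) \<circ>\<^sub>p g))
      = (g + d) * (f \<circ>\<^sub>p (g + d) - (f \<circ>\<^sub>p g + d * (pderiv f \<circ>\<^sub>p g))) + d\<^sup>2 * (pderiv f \<circ>\<^sub>p g)"
    by (simp add: pcompose_pCons pderiv_pCons pcompose_add algebra_simps power2_eq_square)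
  then show ?case using pCons.IH by (simp add: dvd_add)
qed (simp add: pderiv_0)

text \<open>
  The Chinese remainder theorem, with a common exponent for all moduli.
\<close>

lemma chinese_remainder_irreducible_powers:
  fixes P :: "'a::field poly set"
  assumes "finite P" and irr: "\<And>p. p \<in> P \<Longrightarrow> irreducible p \<and> lead_coeff p = 1"
  shows "\<exists>g. \<forall>p\<in>P. p ^ K dvd g - c p"
  using assms
proof (induction P)
  case (insert p P)
  then obtain g where g: "\<forall>q\<in>P. q ^ K dvd g - c q" by auto
  define M where "M = (\<Prod>q\<in>P. q ^ K)"
  have p: "irreducible p" "lead_coeff p = 1" using insert.prems by auto
  have "\<not> p dvd M"
  proof
    assume "p dvd M"
    then obtain q where "q \<in> P" "p dvd q ^ K"
      unfolding M_def using irreducible_dvd_prod[OF p(1) insert.hyps(1)] by blast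
    then have "p dvd q" "irreducible q" "lead_coeff q = 1"
      using irreducible_dvd_power[OF p(1)] insert.prems by auto
    then have "p = q" using monic_irreducible_dvd_imp_eq p by blast
    then show False using \<open>q \<in> P\<close> insert.hyps by simp
  qed
  then obtain a b where ab: "a * M + b * p ^ K = 1" using irreducible_bezout_power[OF p(1)] by blast
  define g' where "g' = g + M * (a * (c p - g))"
  have "g' - c p = (1 - a * M) * (g - c p)" unfolding g'_def by (simp add: algebra_simps)
  also have "1 - a * M = b * p ^ K" using ab by (simp add: algebra_simps)
  finally have "p ^ K dvd g' - c p" by (metis dvd_mult dvd_mult2 dvd_refl)
  moreover have "q ^ K dvd g' - c q" if "q \<in> P" for q
  proof -
    have "q ^ K dvd M" unfolding M_def using that insert.hyps(1) by (rule dvd_prodI[rotated])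
    then have "q ^ K dvd (g - c q) + M * (a * (c p - g))" using g that by (simp add: dvd_add)
    then show ?thesis by (simp add: g'_def algebra_simps)
  qed
  ultimately show ?case by blast
qed simp

section \<open>Transporting residue rings along a polynomial substitution\<close>

text \<open>
  For irreducible \<open>p\<close> and \<open>q\<close> this is the condition under which substituting \<open>g\<close> for the
  variable induces isomorphisms from the polynomials modulo \<open>q ^ k\<close> to those modulo \<open>p ^ k\<close>
  for all \<open>k\<close> at once: \<open>q\<close> is sent to a uniformizer at \<open>p\<close>, and the residue fields correspond.
\<close>

definition lifts_to :: "'a::field poly \<Rightarrow> 'a poly \<Rightarrow> 'a poly \<Rightarrow> bool" where
  "lifts_to p q g \<longleftrightarrow> p dvd q \<circ>\<^sub>p g \<and> \<not> p\<^sup>2 dvd q \<circ>\<^sub>p g \<and> (\<exists>h. p dvd h \<circ>\<^sub>p g - [:0, 1:])"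

lemma not_dvd_pcompose:
  fixes p q g s :: "'a::field poly"
  assumes p: "irreducible p" and q: "irreducible q" and pq: "p dvd q \<circ>\<^sub>p g" and "\<not> q dvd s"
  shows "\<not> p dvd s \<circ>\<^sub>p g"
proof
  assume ps: "p dvd s \<circ>\<^sub>p g"
  obtain a b where "a * s + b * q = 1" using irreducible_bezout[OF q assms(4)] by blast
  then have "(a * s + b * q) \<circ>\<^sub>p g = 1" by (simp add: pcompose_1)
  then have "(a \<circ>\<^sub>p g) * (s \<circ>\<^sub>p g) + (b \<circ>\<^sub>p g) * (q \<circ>\<^sub>p g) = 1"
    by (simp add: pcompose_add pcompose_mult)
  then have "p dvd 1" using ps pq by (metis dvd_add dvd_mult)
  then show False using p by (simp add: Factorial_Ring.irreducible_def)
qed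

lemma lifts_to_cofactor:
  assumes "lifts_to p q g" "irreducible p"
  obtains u where "q \<circ>\<^sub>p g = p * u" "\<not> p dvd u"
proof -
  obtain u where u: "q \<circ>\<^sub>p g = p * u" using assms(1) by (auto simp: lifts_to_def)
  have "\<not> p dvd u"
  proof
    assume "p dvd u"
    then have "p\<^sup>2 dvd q \<circ>\<^sub>p g" by (simp add: u power2_eq_square mult_dvd_mono)
    then show False using assms(1) by (simp add: lifts_to_def)
  qed
  then show thesis using u that by blast
qed

text \<open>
  Injectivity modulo all powers: a polynomial \<open>q ^ e * c\<close> with \<open>c\<close> prime to \<open>q\<close> is sent to
  \<open>p ^ e\<close> times a unit modulo \<open>p\<close>, because \<open>p\<close> divides the image of \<open>q\<close> exactly once.
\<close>

lemma lifts_to_power_dvd_iff: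
  assumes p: "irreducible p" and q: "irreducible q" and l: "lifts_to p q g"
  shows "p ^ k dvd f \<circ>\<^sub>p g \<longleftrightarrow> q ^ k dvd f"
proof (cases "f = 0")
  case False
  obtain u where u: "q \<circ>\<^sub>p g = p * u" "\<not> p dvd u" using lifts_to_cofactor[OF l p] .
  obtain e c where f: "f = q ^ e * c" "\<not> q dvd c"
    using split_off_power[OF False irreducible_degree_pos[OF q]] by blast
  have pc: "\<not> p dvd c \<circ>\<^sub>p g" by (rule not_dvd_pcompose[OF p q _ f(2)]) (simp add: u)
  have pe: "p \<noteq> 0" "q \<noteq> 0" using p q by auto
  have nd: "\<not> p dvd u ^ e * c \<circ>\<^sub>p g"
    using pc u(2) irreducible_dvd_power[OF p] by (auto simp: irreducible_dvd_mult[OF p])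
  have fg: "f \<circ>\<^sub>p g = p ^ e * (u ^ e * c \<circ>\<^sub>p g)"
    by (simp add: f pcompose_mult pcompose_power u power_mult_distrib)
  have *: "a ^ k dvd a ^ e * b \<longleftrightarrow> k \<le> e" if "a \<noteq> 0" "\<not> a dvd b" for a b :: "'a poly"
  proof
    assume "a ^ k dvd a ^ e * b"
    show "k \<le> e"
    proof (rule ccontr)
      assume "\<not> k \<le> e"
      then have "a ^ e * a dvd a ^ k" by (metis le_imp_power_dvd not_less_eq_eq power_Suc2)
      then have "a ^ e * a dvd a ^ e * b" using \<open>a ^ k dvd _\<close> dvd_trans by blast
      then show False using that by simp
    qed
  qed (simp add: le_imp_power_dvd)
  show ?thesis unfolding fg *[OF pe(1) nd] unfolding f(1) *[OF pe(2) f(2)] ..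
qed simp

text \<open>
  Surjectivity modulo all powers. The approximate inverse \<open>h\<close> of \<open>g\<close> is improved step by step:
  modulo \<open>p ^ Suc k\<close> the error \<open>p ^ k * w\<close> is absorbed by a multiple of \<open>q ^ k\<close>, which \<open>g\<close> sends
  to \<open>p ^ k\<close> times a unit modulo \<open>p\<close>.
\<close>

lemma lifts_to_inverse:
  assumes p: "irreducible p" and q: "irreducible q" and l: "lifts_to p q g"
  shows "\<exists>h. p ^ k dvd h \<circ>\<^sub>p g - [:0, 1:]"
proof -
  obtain u where u: "q \<circ>\<^sub>p g = p * u" "\<not> p dvd u" using lifts_to_cofactor[OF l p] .
  obtain h0 where h0: "p dvd h0 \<circ>\<^sub>p g - [:0, 1:]" using l by (auto simp: lifts_to_def)
  have onto: "p dvd (a \<circ>\<^sub>p h0) \<circ>\<^sub>p g - a" for a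
  proof -
    have "h0 \<circ>\<^sub>p g - [:0, 1:] dvd a \<circ>\<^sub>p (h0 \<circ>\<^sub>p g) - a \<circ>\<^sub>p [:0, 1:]" by (rule dvd_pcompose_diff)
    then show ?thesis using h0 dvd_trans by (auto simp: pcompose_assoc)
  qed
  show ?thesis
  proof (induction k)
    case (Suc k)
    then obtain h w where w: "h \<circ>\<^sub>p g - [:0, 1:] = p ^ k * w" by (auto elim: dvdE)
    have "\<not> p dvd u ^ k" using u(2) irreducible_dvd_power[OF p] by blast
    then obtain a b where ab: "a * u ^ k + b * p = 1" using irreducible_bezout[OF p] by blast
    define s where "s = (a * w) \<circ>\<^sub>p h0"
    obtain t where t: "s \<circ>\<^sub>p g = a * w + p * t"
      using onto[of "a * w"] unfolding s_def by (metis add.commute diff_add_cancel dvdE)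
    have "(h - q ^ k * s) \<circ>\<^sub>p g - [:0, 1:] = p ^ k * (w - u ^ k * (s \<circ>\<^sub>p g))"
      using w by (simp add: pcompose_diff pcompose_mult pcompose_power u power_mult_distrib algebra_simps)
    also have "w - u ^ k * (s \<circ>\<^sub>p g) = (a * u ^ k + b * p) * w - u ^ k * (a * w + p * t)"
      by (simp add: t ab)
    also have "\<dots> = p * (b * w - u ^ k * t)" by (simp add: algebra_simps)
    finally have "p ^ Suc k dvd (h - q ^ k * s) \<circ>\<^sub>p g - [:0, 1:]" by simp
    then show ?case by blast
  qed simp
qed

lemma lifts_to_cong:
  assumes l: "lifts_to p q g" and "p\<^sup>2 dvd g' - g"
  shows "lifts_to p q g'"
proof -
  have p2: "p\<^sup>2 dvd f \<circ>\<^sub>p g' - f \<circ>\<^sub>p g" for f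
    using assms(2) dvd_pcompose_diff dvd_trans by blast
  then have p1: "p dvd f \<circ>\<^sub>p g' - f \<circ>\<^sub>p g" for f
    using dvd_trans by (metis dvd_triv_left power2_eq_square)
  obtain h where "p dvd h \<circ>\<^sub>p g - [:0, 1:]" using l by (auto simp: lifts_to_def)
  then have "p dvd h \<circ>\<^sub>p g' - [:0, 1:]" using p1 dvd_diff_trans by blast
  moreover have "p dvd q \<circ>\<^sub>p g'"
    using p1[of q] l unfolding lifts_to_def by (metis diff_add_cancel dvd_add)
  moreover have "\<not> p\<^sup>2 dvd q \<circ>\<^sub>p g'"
    using dvd_diff_imp_dvd_iff[OF p2[of q]] l unfolding lifts_to_def by blast
  ultimately show ?thesis by (auto simp: lifts_to_def)
qed

text \<open>
  For irreducible \<open>p\<close> and \<open>q\<close>, substituting \<open>g\<close> and substituting \<open>h\<close> are mutually inverse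
  isomorphisms between the polynomials modulo \<open>q\<close> and the polynomials modulo \<open>p\<close>. One
  composite being the identity suffices, since both residue rings are fields.
\<close>

definition residue_iso :: "'a::field poly \<Rightarrow> 'a poly \<Rightarrow> 'a poly \<Rightarrow> 'a poly \<Rightarrow> bool" where
  "residue_iso p q g h \<longleftrightarrow> p dvd q \<circ>\<^sub>p g \<and> q dvd p \<circ>\<^sub>p h \<and> p dvd h \<circ>\<^sub>p g - [:0, 1:]"

text \<open>
  An isomorphism of residue fields is induced by many \<open>g\<close>; one of them must carry \<open>q\<close> to a
  polynomial not divisible by \<open>p\<^sup>2\<close>. If \<open>q\<close> is separable, Taylor expansion shows that \<open>g\<close> and
  \<open>g + p\<close> cannot both fail. If \<open>q\<close> is inseparable, so is \<open>p\<close> by hypothesis, and already \<open>g\<close> works: were \<open>q\<close>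
  sent to zero modulo \<open>p\<^sup>2\<close>, then also \<open>p \<circ>\<^sub>p h\<close>, a multiple of \<open>q\<close>, so that
  \<open>p\<^sup>2\<close> divides \<open>p \<circ>\<^sub>p ([:0, 1:] + p * w)\<close> for some \<open>w\<close>. As \<open>p\<close> has derivative zero, the latter is
  congruent to \<open>p\<close> modulo \<open>p\<^sup>2\<close>, which is absurd.
\<close>

lemma residue_iso_lifts_to:
  fixes p q :: "'a::field poly"
  assumes p: "irreducible p" and q: "irreducible q" and iso: "residue_iso p q g h"
    and insep: "pderiv q = 0 \<Longrightarrow> pderiv p = 0"
  shows "\<exists>g'. lifts_to p q g'"
proof (cases "pderiv q = 0")
  case True
  have "\<not> p\<^sup>2 dvd q \<circ>\<^sub>p g"
  proof
    assume p2: "p\<^sup>2 dvd q \<circ>\<^sub>p g"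
    obtain w where w: "h \<circ>\<^sub>p g = [:0, 1:] + p * w"
      using iso unfolding residue_iso_def by (metis add.commute diff_add_cancel dvdE)
    have "q \<circ>\<^sub>p g dvd (p \<circ>\<^sub>p h) \<circ>\<^sub>p g" using iso by (auto simp: residue_iso_def intro: pcompose_dvd)
    then have "p\<^sup>2 dvd p \<circ>\<^sub>p ([:0, 1:] + p * w)"
      using p2 dvd_trans by (auto simp: pcompose_assoc[symmetric] w)
    moreover have "p\<^sup>2 dvd p \<circ>\<^sub>p ([:0, 1:] + p * w) - p"
    proof -
      have "(p * w)\<^sup>2 dvd p \<circ>\<^sub>p ([:0, 1:] + p * w) - p"
        using pcompose_taylor[of "p * w" p "[:0, 1:]"] insep True by simp
      then show ?thesis using dvd_trans by (metis dvd_triv_left power_mult_distrib)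
    qed
    ultimately have "p\<^sup>2 dvd p" using dvd_diff_imp_dvd_iff by blast
    then have "p * p dvd p * 1" by (simp add: power2_eq_square)
    then have "p dvd 1" using p by (subst (asm) dvd_mult_cancel_left) auto
    then show False using p by (simp add: Factorial_Ring.irreducible_def)
  qed
  then show ?thesis using iso unfolding residue_iso_def lifts_to_def by blast
next
  case False
  have "degree (pderiv q) \<le> degree q - 1"
    by (rule degree_le) (auto simp: coeff_pderiv intro: coeff_eq_0)
  then have "degree (pderiv q) < degree q" using irreducible_degree_pos[OF q] by linarith
  then have nq: "\<not> q dvd pderiv q" using False by (auto dest: dvd_imp_degree_le)
  have pq: "p dvd q \<circ>\<^sub>p g" using iso by (simp add: residue_iso_def)
  have nd: "\<not> p dvd pderiv q \<circ>\<^sub>p g" by (rule not_dvd_pcompose[OF p q pq nq])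
  have step: "lifts_to p q g'" if "p dvd g' - g" "\<not> p\<^sup>2 dvd q \<circ>\<^sub>p g'" for g'
  proof -
    have *: "p dvd f \<circ>\<^sub>p g' - f \<circ>\<^sub>p g" for f using that(1) dvd_pcompose_diff dvd_trans by blast
    have "p dvd h \<circ>\<^sub>p g' - [:0, 1:]"
      using * iso dvd_diff_trans unfolding residue_iso_def by blast
    moreover have "p dvd q \<circ>\<^sub>p g'" using * pq by (metis diff_add_cancel dvd_add)
    ultimately show ?thesis using that unfolding lifts_to_def by blast
  qed
  have "\<not> (p\<^sup>2 dvd q \<circ>\<^sub>p g \<and> p\<^sup>2 dvd q \<circ>\<^sub>p (g + p))"
  proof
    assume "p\<^sup>2 dvd q \<circ>\<^sub>p g \<and> p\<^sup>2 dvd q \<circ>\<^sub>p (g + p)"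
    moreover have "p\<^sup>2 dvd q \<circ>\<^sub>p (g + p) - (q \<circ>\<^sub>p g + p * (pderiv q \<circ>\<^sub>p g))" by (rule pcompose_taylor)
    ultimately have "p\<^sup>2 dvd p * (pderiv q \<circ>\<^sub>p g)"
      using dvd_diff_imp_dvd_iff dvd_add_right_iff by blast
    then have "p * p dvd p * (pderiv q \<circ>\<^sub>p g)" by (simp add: power2_eq_square)
    then show False using nd p by (subst (asm) dvd_mult_cancel_left) auto
  qed
  then show ?thesis using step[of g] step[of "g + p"] by auto
qed

section \<open>Cyclic decomposition of modules of finite length over polynomials\<close>

text \<open>
  The vectors \<open>v i\<close> with \<open>i < r\<close> generate the module \<open>W\<close>, and the relations between them are exactly those
  that make \<open>W\<close> the direct sum of the cyclic modules of polynomials modulo \<open>P i\<close>.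
\<close>

definition presents ::
    "('a::field poly \<Rightarrow> 'v::ab_group_add \<Rightarrow> 'v) \<Rightarrow> 'v set \<Rightarrow> nat \<Rightarrow> (nat \<Rightarrow> 'v) \<Rightarrow> (nat \<Rightarrow> 'a poly) \<Rightarrow> bool" where
  "presents act W r v P \<longleftrightarrow> (\<forall>i<r. v i \<in> W) \<and> (\<forall>w\<in>W. \<exists>f. w = (\<Sum>i<r. act (f i) (v i)))
     \<and> (\<forall>f. (\<Sum>i<r. act (f i) (v i)) = 0 \<longleftrightarrow> (\<forall>i<r. P i dvd f i))"

text \<open>
  The function \<open>len\<close> bounds the length of chains of submodules; for the module of a
  linear operator it is the dimension.
\<close>

locale finite_length_module = Modules.module act
  for act :: "'a::field poly \<Rightarrow> 'v::ab_group_add \<Rightarrow> 'v" +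
  fixes len :: "'v set \<Rightarrow> nat"
  assumes len_strict: "subspace U \<Longrightarrow> subspace W \<Longrightarrow> U \<subset> W \<Longrightarrow> len U < len W"
begin

lemma len_mono: "subspace U \<Longrightarrow> subspace W \<Longrightarrow> U \<subseteq> W \<Longrightarrow> len U \<le> len W"
  using len_strict by (cases "U = W") (auto simp: less_imp_le)

text \<open>
  The submodules generated by \<open>v\<close>, \<open>X v\<close>, \<open>X\<^sup>2 v\<close>, \<open>\<dots>\<close> cannot descend forever, and an equality
  between consecutive ones is a nontrivial relation.
\<close>

lemma torsion: "\<exists>f. f \<noteq> 0 \<and> act f v = 0"
proof -
  define x where "x = [:0, 1 :: 'a:]"
  define S where "S = (\<lambda>i. span {act (x ^ i) v})"
  have sub: "subspace (S i)" for i by (simp add: S_def)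
  have desc: "S (Suc i) \<subseteq> S i" for i
  proof -
    have "act (x ^ Suc i) v = act x (act (x ^ i) v)" by simp
    then have "act (x ^ Suc i) v \<in> S i" unfolding S_def by (metis span_base span_scale singletonI)
    then show ?thesis unfolding S_def by (intro span_minimal) auto
  qed
  have "\<exists>i. S (Suc i) = S i"
  proof (rule ccontr)
    assume "\<nexists>i. S (Suc i) = S i"
    then have lt: "len (S (Suc i)) < len (S i)" for i using desc sub len_strict by blast
    have "len (S i) + i \<le> len (S 0)" for i
    proof (induction i)
      case (Suc i) then show ?case using lt[of i] by simp
    qed simp
    from this[of "Suc (len (S 0))"] show False by simp
  qed
  then obtain i where "S (Suc i) = S i" by blast
  then have "act (x ^ i) v \<in> span {act (x ^ Suc i) v}" unfolding S_def by (auto intro: span_base)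
  then obtain g where "act (x ^ i) v = act g (act (x ^ Suc i) v)" by (auto simp: span_singleton)
  then have "act (x ^ i * (1 - x * g)) v = 0"
    by (simp add: scale_left_diff_distrib algebra_simps)
  moreover have "x ^ i * (1 - x * g) \<noteq> 0"
  proof -
    have "poly (1 - x * g) 0 = 1" by (simp add: x_def)
    then have "1 - x * g \<noteq> 0" by (metis poly_0 zero_neq_one)
    then show ?thesis by (simp add: x_def)
  qed
  ultimately show ?thesis by blast
qed

text \<open>
  An element outside \<open>S\<close> that is torsion modulo \<open>S\<close> has a multiple generating a simple submodule
  modulo \<open>S\<close>: irreducible factors are removed from \<open>f\<close> one at a time until the image leaves \<open>S\<close>.
\<close>

lemma exists_irreducible_step:
  assumes S: "subspace S" and "f \<noteq> 0" "w \<notin> S" "act f w \<in> S"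
  shows "\<exists>p a. irreducible p \<and> lead_coeff p = 1 \<and> act a w \<notin> S \<and> act (p * a) w \<in> S"
  using assms(2,4)
proof (induction "degree f" arbitrary: f rule: less_induct)
  case less
  show ?case
  proof (cases "degree f = 0")
    case True
    then obtain c where c: "f = [:c:]" by (metis degree_eq_zeroE)
    have "w = act [:inverse c:] (act f w)" using less.prems(1) by (simp add: c one_pCons[symmetric])
    then show ?thesis using subspace_scale[OF S less.prems(2)] assms(3) by metis
  next
    case False
    then obtain p where p: "irreducible p" "lead_coeff p = 1" "p dvd f"
      using exists_monic_irreducible_dvd by blast
    then obtain a where a: "f = p * a" by blast
    then have nz: "a \<noteq> 0" "p \<noteq> 0" using less.prems by auto
    show ?thesis
    proof (cases "act a w \<in> S")
      case True
      have "degree a < degree f"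
        using a nz irreducible_degree_pos[OF p(1)] by (simp add: degree_mult_eq)
      then show ?thesis using less.hyps nz True by blast
    next
      case False
      then show ?thesis using p a less.prems by blast
    qed
  qed
qed

text \<open>
  The annihilator of \<open>v\<close> is an ideal that contains \<open>p ^ Suc k\<close> but not \<open>p ^ k\<close>, and these are consecutive divisors.
\<close>

lemma annihilator_power:
  assumes p: "irreducible p" and v: "act (p ^ Suc k) v = 0" "act (p ^ k) v \<noteq> 0"
  shows "act f v = 0 \<longleftrightarrow> p ^ Suc k dvd f"
proof
  assume "p ^ Suc k dvd f"
  then obtain g where "f = g * p ^ Suc k" by (metis dvdE mult.commute)
  then have "act f v = act g (act (p ^ Suc k) v)" by (simp only: scale_scale)
  then show "act f v = 0" by (simp only: v(1) scale_zero_right)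
next
  assume f0: "act f v = 0"
  show "p ^ Suc k dvd f"
  proof (cases "f = 0")
    case False
    obtain e c where f: "f = p ^ e * c" "\<not> p dvd c"
      using split_off_power[OF False irreducible_degree_pos[OF p]] by blast
    obtain a b where ab: "a * c + b * p ^ Suc k = 1" using irreducible_bezout_power[OF p f(2)] by blast
    have "p ^ e = p ^ e * (a * c + b * p ^ Suc k)" by (simp only: ab mult_1_right)
    also have "\<dots> = a * f + p ^ e * b * p ^ Suc k" by (simp add: f algebra_simps)
    finally have "act (p ^ e) v = act (a * f) v + act (p ^ e * b * p ^ Suc k) v"
      by (metis scale_left_distrib)
    also have "\<dots> = act a (act f v) + act (p ^ e * b) (act (p ^ Suc k) v)" by (simp only: scale_scale)
    finally have e0: "act (p ^ e) v = 0" by (simp only: f0 v(1) scale_zero_right add_0_right)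
    have "Suc k \<le> e"
    proof (rule ccontr)
      assume "\<not> Suc k \<le> e"
      then have "p ^ k = p ^ (k - e) * p ^ e" by (simp add: power_add[symmetric])
      then have "act (p ^ k) v = act (p ^ (k - e)) (act (p ^ e) v)" by simp
      then show False using e0 v(2) by simp
    qed
    then show ?thesis unfolding f(1) by (intro dvd_mult2 le_imp_power_dvd)
  qed simp
qed

text \<open>
  A cyclic submodule of maximal \<open>p\<close>-power order is a direct summand. A submodule \<open>U\<close> maximal among those that meet
  \<open>span {v}\<close> trivially is a complement. Otherwise some \<open>w1\<close> outside \<open>S = U + span {v}\<close> is carried into \<open>S\<close> by an
  irreducible \<open>r\<close>. Correcting it by a multiple of \<open>v\<close> gives \<open>x\<close> outside \<open>S\<close> with \<open>act r x\<close> in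
  \<open>U\<close>: the component of \<open>act r w1\<close> in \<open>span {v}\<close> is divisible by \<open>r\<close>, trivially if
  \<open>r \<noteq> p\<close>, and by maximality of the order of \<open>v\<close> if \<open>r = p\<close>. But then \<open>U\<close> could be
  enlarged by \<open>x\<close>.
\<close>

lemma exists_complement:
  assumes W: "subspace W" and p: "irreducible p" "lead_coeff p = 1"
    and v: "v \<in> W" "act (p ^ Suc k) v = 0" "act (p ^ k) v \<noteq> 0"
    and max: "\<And>w j. w \<in> W \<Longrightarrow> act (p ^ j) w = 0 \<Longrightarrow> act (p ^ Suc k) w = 0"
  shows "\<exists>U. subspace U \<and> U \<subseteq> W \<and> U \<inter> span {v} = {0} \<and> (\<forall>w\<in>W. \<exists>u\<in>U. \<exists>f. w = u + act f v)"
proof -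
  let ?ok = "\<lambda>U. subspace U \<and> U \<subseteq> W \<and> U \<inter> span {v} = {0}"
  have ann: "act f v = 0 \<longleftrightarrow> p ^ Suc k dvd f" for f by (rule annihilator_power[OF p(1) v(2,3)])
  have "?ok {0}" using subspace_0[OF W] by (auto simp: span_zero)
  moreover have "\<forall>U. ?ok U \<longrightarrow> len U \<le> len W" using len_mono W by blast
  ultimately obtain U where U: "subspace U" "U \<subseteq> W" "U \<inter> span {v} = {0}"
    and Umax: "\<And>U'. ?ok U' \<Longrightarrow> len U' \<le> len U"
    using ex_has_greatest_nat[of ?ok "{0}" len "Suc (len W)"] by (auto simp: less_Suc_eq_le)
  define S where "S = {u + act f v | u f. u \<in> U}"
  have S_I: "u + act f v \<in> S" if "u \<in> U" for u f using that unfolding S_def by blast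
  have S: "subspace S"
  proof (rule subspaceI)
    show "0 \<in> S" using S_I[of 0 0] subspace_0[OF U(1)] by simp
    fix x y assume "x \<in> S" "y \<in> S"
    then obtain a b f g where "x = a + act f v" "y = b + act g v" "a \<in> U" "b \<in> U"
      unfolding S_def by blast
    then show "x + y \<in> S"
      using S_I[of "a + b" "f + g"] subspace_add[OF U(1)] by (simp add: scale_left_distrib algebra_simps)
  next
    fix c x assume "x \<in> S"
    then obtain a f where "x = a + act f v" "a \<in> U" unfolding S_def by blast
    then show "act c x \<in> S"
      using S_I[of "act c a" "c * f"] subspace_scale[OF U(1)] by (simp add: scale_right_distrib)
  qed
  have US: "u \<in> S" if "u \<in> U" for u using S_I[OF that, of 0] by simp
  have vS: "act f v \<in> S" for f using S_I[of 0 f] subspace_0[OF U(1)] by simp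
  \<comment> \<open>Adding such an \<open>x\<close> to \<open>U\<close> would keep the intersection with \<open>span {v}\<close> trivial.\<close>
  have key: False if x: "x \<in> W" "x \<notin> S" and r: "irreducible r" "act r x \<in> U" for x r
  proof -
    define U' where "U' = {u + act s x | u s. u \<in> U}"
    have U'_I: "u + act s x \<in> U'" if "u \<in> U" for u s using that unfolding U'_def by blast
    have U': "subspace U'"
    proof (rule subspaceI)
      show "0 \<in> U'" using U'_I[of 0 0] subspace_0[OF U(1)] by simp
      fix y z assume "y \<in> U'" "z \<in> U'"
      then obtain a b f g where "y = a + act f x" "z = b + act g x" "a \<in> U" "b \<in> U"
        unfolding U'_def by blast
      then show "y + z \<in> U'"
        using U'_I[of "a + b" "f + g"] subspace_add[OF U(1)] by (simp add: scale_left_distrib algebra_simps)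
    next
      fix c y assume "y \<in> U'"
      then obtain a f where "y = a + act f x" "a \<in> U" unfolding U'_def by blast
      then show "act c y \<in> U'"
        using U'_I[of "act c a" "c * f"] subspace_scale[OF U(1)] by (simp add: scale_right_distrib)
    qed
    have UU': "U \<subseteq> U'" using U'_I[of _ 0] by auto
    have xU': "x \<in> U'" using U'_I[of 0 1] subspace_0[OF U(1)] by simp
    have "U \<subset> U'" using UU' xU' US x(2) by blast
    then have "len U < len U'" by (rule len_strict[OF U(1) U'])
    moreover have "U' \<subseteq> W"
      unfolding U'_def using U(2) x(1) by (auto intro!: subspace_add[OF W] subspace_scale[OF W])
    ultimately have "U' \<inter> span {v} \<noteq> {0}" using Umax U' by (metis not_le)
    moreover have "0 \<in> U' \<inter> span {v}" using subspace_0[OF U'] by (simp add: span_zero)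
    ultimately obtain z where z: "z \<in> U'" "z \<in> span {v}" "z \<noteq> 0" by blast
    obtain u s where us: "z = u + act s x" "u \<in> U" using z(1) unfolding U'_def by blast
    obtain f where f: "z = act f v" using z(2) by (auto simp: span_singleton)
    show False
    proof (cases "r dvd s")
      case True
      then obtain t where "s = t * r" by (metis dvdE mult.commute)
      then have "act s x = act t (act r x)" by simp
      then have "z \<in> U"
        unfolding us(1) using us(2) r(2) subspace_add[OF U(1)] subspace_scale[OF U(1)] by metis
      then show False using z U(3) by blast
    next
      case False
      then obtain a b where ab: "a * s + b * r = 1" using irreducible_bezout[OF r(1)] by blast
      have "x = act (a * s + b * r) x" by (simp add: ab)
      also have "\<dots> = act a (act s x) + act b (act r x)" by (simp add: scale_left_distrib)
      also have "act s x = act f v - u" using us(1) f by simp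
      finally have "x = act a (act f v - u) + act b (act r x)" .
      moreover have "act a (act f v - u) + act b (act r x) \<in> S"
        by (intro subspace_add[OF S] subspace_scale[OF S] subspace_diff[OF S] vS US r(2) us(2))
      ultimately show False using x(2) by simp
    qed
  qed
  have "w \<in> S" if w: "w \<in> W" for w
  proof (rule ccontr)
    assume wS: "w \<notin> S"
    obtain f where "f \<noteq> 0" "act f w = 0" using torsion by blast
    then obtain r a where r: "irreducible r" "lead_coeff r = 1" "act a w \<notin> S" "act (r * a) w \<in> S"
      using exists_irreducible_step[OF S _ wS] subspace_0[OF S] by metis
    define w1 where "w1 = act a w"
    have w1: "w1 \<in> W" "w1 \<notin> S" "act r w1 \<in> S"
      using r w subspace_scale[OF W] by (simp_all add: w1_def)
    obtain x where x: "x \<in> W" "x \<notin> S" "act r x \<in> U"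
    proof (cases "r = p")
      case False
      obtain u f where u: "act r w1 = u + act f v" "u \<in> U" using w1(3) unfolding S_def by blast
      have "\<not> r dvd p" using monic_irreducible_dvd_imp_eq r(1,2) p False by blast
      then have "\<not> p dvd r" using monic_irreducible_dvd_imp_eq r(1,2) p False by blast
      then obtain a b where ab: "a * r + b * p ^ Suc k = 1" using irreducible_bezout_power[OF p(1)] by blast
      have "act f v = act ((a * r + b * p ^ Suc k) * f) v" by (simp only: ab mult_1_left)
      also have "(a * r + b * p ^ Suc k) * f = r * (a * f) + (b * f) * p ^ Suc k" by (simp add: algebra_simps)
      also have "act \<dots> v = act r (act (a * f) v) + act (b * f) (act (p ^ Suc k) v)"
        by (simp only: scale_left_distrib scale_scale)
      finally have fv: "act f v = act r (act (a * f) v)" by (simp only: v(2) scale_zero_right add_0_right)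
      have "act r (w1 - act (a * f) v) = u"
        unfolding scale_right_diff_distrib u(1) by (subst (1) fv) simp
      moreover have "w1 - act (a * f) v \<notin> S"
        using w1(2) vS subspace_add[OF S] by (metis diff_add_cancel)
      ultimately show thesis
        using that u(2) w1(1) v(1) subspace_diff[OF W] subspace_scale[OF W] by metis
    next
      case True
      \<comment> \<open>The hypothesis on the order of \<open>v\<close> concerns \<open>p\<close>-primary elements only, so \<open>w1\<close> is first
        replaced by its \<open>p\<close>-primary multiple \<open>w2\<close>.\<close>
      obtain f1 where "f1 \<noteq> 0" "act f1 w1 = 0" using torsion by blast
      then obtain e c where ec: "f1 = p ^ e * c" "\<not> p dvd c"
        using split_off_power irreducible_degree_pos[OF p(1)] by blast
      define w2 where "w2 = act c w1"
      obtain a b where ab: "a * c + b * p = 1" using irreducible_bezout[OF p(1) ec(2)] by blast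
      have "act (p ^ e) w2 = 0" using ec(1) \<open>act f1 w1 = 0\<close> by (simp add: w2_def)
      have w2: "w2 \<in> W" "act p w2 \<in> S"
      proof -
        show "w2 \<in> W" using w1(1) subspace_scale[OF W] by (simp add: w2_def)
        have "act p w2 = act c (act p w1)" by (simp add: w2_def mult.commute)
        moreover have "act c (act p w1) \<in> S" by (rule subspace_scale[OF S]) (use w1(3) True in simp)
        ultimately show "act p w2 \<in> S" by (simp only:)
      qed
      have w2S: "w2 \<notin> S"
      proof
        assume "w2 \<in> S"
        have "w1 = act (a * c + b * p) w1" by (simp add: ab)
        also have "\<dots> = act a w2 + act b (act p w1)" by (simp add: scale_left_distrib w2_def)
        also have "\<dots> \<in> S"
          using subspace_add[OF S subspace_scale[OF S \<open>w2 \<in> S\<close>] subspace_scale[OF S w1(3)]] True by simp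
        finally show False using w1(2) by simp
      qed
      have pk: "act (p ^ k * p) w2 = 0" using max[OF w2(1) \<open>act (p ^ e) w2 = 0\<close>] by (simp add: mult.commute)
      obtain u f where u: "act p w2 = u + act f v" "u \<in> U" using w2(2) unfolding S_def by blast
      have "0 = act (p ^ k) u + act (p ^ k * f) v"
        using pk unfolding scale_scale[symmetric] u(1) by (simp add: scale_right_distrib)
      then have e: "act (- (p ^ k * f)) v = act (p ^ k) u" by (simp add: add_eq_0_iff2)
      have "act (p ^ k) u \<in> U" using subspace_scale[OF U(1) u(2)] .
      moreover have "act (- (p ^ k * f)) v \<in> span {v}" unfolding span_singleton by blast
      ultimately have "act (- (p ^ k * f)) v = 0" using U(3) e by (metis IntI singletonD)
      then have "p ^ Suc k dvd p ^ k * f" using ann by (metis dvd_minus_iff)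
      then have "p ^ k * p dvd p ^ k * f" by (simp add: mult.commute)
      then have "p dvd f" using p(1) by (subst (asm) dvd_mult_cancel_left) auto
      then obtain g where g: "f = p * g" by blast
      have "act p (w2 - act g v) = u" using u(1) by (simp add: scale_right_diff_distrib g)
      moreover have "w2 - act g v \<notin> S" using w2S vS subspace_add[OF S] by (metis diff_add_cancel)
      ultimately show thesis
        using that True u(2) w2(1) v(1) subspace_diff[OF W] subspace_scale[OF W] by metis
    qed
    show False by (rule key[OF x(1,2) r(1) x(3)])
  qed
  then have "\<forall>w\<in>W. \<exists>u\<in>U. \<exists>f. w = u + act f v" unfolding S_def by blast
  then show ?thesis using U by blast
qed

text \<open>
  The kernels \<open>K j\<close> of the powers of a suitable irreducible \<open>p\<close> form an increasing chain, which becomes stationary; \<open>v\<close> is chosen in the last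
  step of the chain.
\<close>

lemma exists_generator_of_maximal_order:
  assumes W: "subspace W" and w: "w \<in> W" "w \<noteq> 0"
  shows "\<exists>p k v. irreducible p \<and> lead_coeff p = 1 \<and> v \<in> W \<and> act (p ^ Suc k) v = 0 \<and> act (p ^ k) v \<noteq> 0
    \<and> (\<forall>u\<in>W. \<forall>j. act (p ^ j) u = 0 \<longrightarrow> act (p ^ Suc k) u = 0)"
proof -
  obtain f where "f \<noteq> 0" "act f w = 0" using torsion by blast
  then obtain p a where p: "irreducible p" "lead_coeff p = 1" and a: "act a w \<noteq> 0" "act (p * a) w = 0"
    using exists_irreducible_step[OF subspace_single_0, of f w] w(2) by auto
  define K where "K = (\<lambda>j. {u \<in> W. act (p ^ j) u = 0})"
  have K: "subspace (K j)" for j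
    unfolding K_def using W
    by (auto intro!: subspaceI simp: subspace_0 subspace_add subspace_scale scale_right_distrib)
       (metis mult.commute scale_scale scale_zero_right)
  have Kmono: "K i \<subseteq> K j" if "i \<le> j" for i j
  proof
    fix u assume u: "u \<in> K i"
    have "p ^ j = p ^ (j - i) * p ^ i" using that by (simp add: power_add[symmetric])
    then have "act (p ^ j) u = act (p ^ (j - i)) (act (p ^ i) u)" by simp
    then show "u \<in> K j" using u by (simp add: K_def del: scale_scale)
  qed
  have "\<forall>j. len (K j) \<le> len W" using len_mono[OF K W] by (auto simp: K_def)
  then obtain m where m: "\<And>j. len (K j) \<le> len (K m)"
    using ex_has_greatest_nat[of "\<lambda>_. True" 0 "\<lambda>j. len (K j)" "Suc (len W)"] by (auto simp: less_Suc_eq_le)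
  have Km: "K j \<subseteq> K m" for j
  proof (cases "j \<le> m")
    case False
    then have "K m = K j" using Kmono[of m j] len_strict[OF K K, of m j] m[of j] by force
    then show ?thesis by simp
  qed (rule Kmono)
  define n where "n = (LEAST n. \<forall>j. K j \<subseteq> K n)"
  have n: "\<forall>j. K j \<subseteq> K n" unfolding n_def by (rule LeastI[of _ m]) (use Km in blast)
  have "K 0 = {0}" using subspace_0[OF W] by (auto simp: K_def)
  moreover have "act a w \<in> K 1" using a(2) w(1) subspace_scale[OF W] by (simp add: K_def)
  ultimately have "n \<noteq> 0" using n a(1) by (metis singletonD subsetD)
  then obtain k where k: "n = Suc k" by (metis not0_implies_Suc)
  have "\<not> (\<forall>j. K j \<subseteq> K k)" using not_less_Least[of k "\<lambda>n. \<forall>j. K j \<subseteq> K n"] unfolding n_def[symmetric] k by simp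
  then obtain v where v: "v \<in> K n" "v \<notin> K k" using n by blast
  have "\<forall>u\<in>W. \<forall>j. act (p ^ j) u = 0 \<longrightarrow> act (p ^ Suc k) u = 0"
    using n unfolding k K_def by blast
  then show ?thesis using p v unfolding k K_def by blast
qed

text \<open>
  Splitting off a cyclic summand of maximal order and continuing with its complement.
\<close>

theorem exists_primary_presentation:
  assumes "subspace W"
  shows "\<exists>r v p k. presents act W r v (\<lambda>i. p i ^ k i)
    \<and> (\<forall>i<r. irreducible (p i) \<and> lead_coeff (p i) = 1 \<and> k i > 0)"
  using assms
proof (induction "len W" arbitrary: W rule: less_induct)
  case less
  note W = less.prems
  show ?case
  proof (cases "W = {0}")
    case True
    then have "presents act W 0 (\<lambda>_. 0) P" for P by (simp add: presents_def)
    then show ?thesis by blast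
  next
    case False
    then obtain w where "w \<in> W" "w \<noteq> 0" using subspace_0[OF W] by blast
    from exists_generator_of_maximal_order[OF W this]
    obtain p k v where p: "irreducible p" "lead_coeff p = 1"
      and v: "v \<in> W" "act (p ^ Suc k) v = 0" "act (p ^ k) v \<noteq> 0"
      and mx: "\<And>u j. u \<in> W \<Longrightarrow> act (p ^ j) u = 0 \<Longrightarrow> act (p ^ Suc k) u = 0" by blast
    have "\<exists>U. subspace U \<and> U \<subseteq> W \<and> U \<inter> span {v} = {0} \<and> (\<forall>w\<in>W. \<exists>u\<in>U. \<exists>f. w = u + act f v)"
      by (rule exists_complement[OF W p v mx])
    then obtain U where U: "subspace U" "U \<subseteq> W" "U \<inter> span {v} = {0}"
      and dec: "\<And>w. w \<in> W \<Longrightarrow> \<exists>u\<in>U. \<exists>f. w = u + act f v"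
      by auto
    have "v \<noteq> 0" using v(3) by auto
    then have "v \<notin> U" using U(3) by (auto intro: span_base)
    then have "U \<subset> W" using U(2) v(1) by blast
    then have "len U < len W" by (rule len_strict[OF U(1) W])
    from less.hyps[OF this U(1)] obtain r v' p' k' where
      pr: "presents act U r v' (\<lambda>i. p' i ^ k' i)"
      and p': "\<And>i. i < r \<Longrightarrow> irreducible (p' i) \<and> lead_coeff (p' i) = 1 \<and> k' i > 0" by blast
    let ?v = "v'(r := v)" and ?p = "p'(r := p)" and ?k = "k'(r := Suc k)"
    have sum: "(\<Sum>i<Suc r. act (f i) (?v i)) = (\<Sum>i<r. act (f i) (v' i)) + act (f r) v" for f
      by simp
    have inU: "(\<Sum>i<r. act (f i) (v' i)) \<in> U" for f
      using pr by (auto simp: presents_def intro!: subspace_sum[OF U(1)] subspace_scale[OF U(1)])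
    have "presents act W (Suc r) ?v (\<lambda>i. ?p i ^ ?k i)"
      unfolding presents_def sum
    proof (intro conjI ballI allI impI)
      fix i assume "i < Suc r" then show "?v i \<in> W" using pr U(2) v(1) by (auto simp: presents_def)
    next
      fix w assume "w \<in> W"
      then obtain u f where u: "u \<in> U" "w = u + act f v" using dec by blast
      then obtain g where g: "u = (\<Sum>i<r. act (g i) (v' i))" using pr by (auto simp: presents_def)
      have "(\<Sum>i<r. act ((g(r := f)) i) (v' i)) = (\<Sum>i<r. act (g i) (v' i))"
        by (rule sum.cong) auto
      then have "w = (\<Sum>i<r. act ((g(r := f)) i) (v' i)) + act ((g(r := f)) r) v" using u g by simp
      then show "\<exists>f. w = (\<Sum>i<r. act (f i) (v' i)) + act (f r) v" by blast
    next
      fix f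
      have "(\<Sum>i<r. act (f i) (v' i)) + act (f r) v = 0 \<longleftrightarrow>
          (\<Sum>i<r. act (f i) (v' i)) = 0 \<and> act (f r) v = 0"
      proof
        assume 0: "(\<Sum>i<r. act (f i) (v' i)) + act (f r) v = 0"
        then have "act (f r) v = - (\<Sum>i<r. act (f i) (v' i))" by (metis add.commute eq_neg_iff_add_eq_0)
        then have "act (f r) v \<in> U" using subspace_neg[OF U(1) inU] by simp
        moreover have "act (f r) v \<in> span {v}" by (simp add: span_scale span_base)
        ultimately have "act (f r) v = 0" using U(3) by blast
        then show "(\<Sum>i<r. act (f i) (v' i)) = 0 \<and> act (f r) v = 0" using 0 by simp
      qed simp
      also have "\<dots> \<longleftrightarrow> (\<forall>i<r. p' i ^ k' i dvd f i) \<and> p ^ Suc k dvd f r"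
        using pr annihilator_power[OF p(1) v(2,3)] by (auto simp: presents_def)
      also have "\<dots> \<longleftrightarrow> (\<forall>i<Suc r. ?p i ^ ?k i dvd f i)" by (auto simp: less_Suc_eq)
      finally show "((\<Sum>i<r. act (f i) (v' i)) + act (f r) v = 0) = (\<forall>i<Suc r. ?p i ^ ?k i dvd f i)" .
    qed
    moreover have "\<forall>i<Suc r. irreducible (?p i) \<and> lead_coeff (?p i) = 1 \<and> ?k i > 0"
      using p p' by (auto simp: less_Suc_eq)
    ultimately show ?thesis by blast
  qed
qed

end

section \<open>Polynomials in a linear operator\<close>

text \<open>
  The vector \<open>f(T) v\<close>, evaluated by Horner's scheme.
\<close>

definition poly_apply ::
    "('a::field \<Rightarrow> 'v::ab_group_add \<Rightarrow> 'v) \<Rightarrow> ('v \<Rightarrow> 'v) \<Rightarrow> 'a poly \<Rightarrow> 'v \<Rightarrow> 'v" where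
  "poly_apply scale T f v = fold_coeffs (\<lambda>a w. scale a v + T w) f 0"

lemma presents_represent:
  assumes "presents act UNIV r v P"
  obtains f where "x = (\<Sum>i<r. act (f i) (v i))"
  using assms unfolding presents_def by blast

lemma presents_eq_0_iff:
  assumes "presents act W r v P"
  shows "(\<Sum>i<r. act (f i) (v i)) = 0 \<longleftrightarrow> (\<forall>i<r. P i dvd f i)"
  using assms unfolding presents_def by blast

abbreviation linear_op :: "('a::field \<Rightarrow> 'v::ab_group_add \<Rightarrow> 'v) \<Rightarrow> ('v \<Rightarrow> 'v) \<Rightarrow> bool" where
  "linear_op scale \<equiv> Vector_Spaces.linear scale scale"

context vector_space
begin

lemma linear_op_iff: "linear_op scale T \<longleftrightarrow> (\<forall>x y. T (x + y) = T x + T y) \<and> (\<forall>c x. T (c *s x) = c *s T x)"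
  by (auto simp: Vector_Spaces.linear_def module_hom_def module_hom_axioms_def
      vector_space_axioms module_axioms)

lemma linear_opD:
  assumes "linear_op scale T"
  shows "T (x + y) = T x + T y" "T (c *s x) = c *s T x" "T 0 = 0" "T (- x) = - T x"
    "T (x - y) = T x - T y" "T (sum u A) = (\<Sum>i\<in>A. T (u i))"
proof -
  interpret Vector_Spaces.linear scale scale T by fact
  show "T (x + y) = T x + T y" "T (c *s x) = c *s T x" "T 0 = 0" "T (- x) = - T x"
    "T (x - y) = T x - T y" "T (sum u A) = (\<Sum>i\<in>A. T (u i))"
    by (rule add scale zero neg diff sum)+
qed

lemma poly_apply_0 [simp]: "poly_apply scale T 0 v = 0"
  by (simp add: poly_apply_def)

lemma poly_apply_pCons:
  assumes "linear_op scale T"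
  shows "poly_apply scale T (pCons a f) v = a *s v + T (poly_apply scale T f v)"
  using linear_opD(3)[OF assms] by (cases "a = 0 \<and> f = 0") (auto simp: poly_apply_def fold_coeffs_pCons_eq)

lemma poly_apply_const: "linear_op scale T \<Longrightarrow> poly_apply scale T [:c:] v = c *s v"
  by (simp add: poly_apply_pCons linear_opD(3))

lemma poly_apply_1: "linear_op scale T \<Longrightarrow> poly_apply scale T 1 v = v"
  by (simp add: one_pCons poly_apply_const)

lemma poly_apply_X: "linear_op scale T \<Longrightarrow> poly_apply scale T [:0, 1:] v = T v"
  by (simp add: poly_apply_pCons poly_apply_const linear_opD(3))

lemma poly_apply_add:
  assumes T: "linear_op scale T"
  shows "poly_apply scale T (f + g) v = poly_apply scale T f v + poly_apply scale T g v"
proof (induction f g rule: poly_induct2)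
  case (pCons a f b g)
  then show ?case by (simp add: poly_apply_pCons[OF T] linear_opD(1)[OF T] scale_left_distrib algebra_simps)
qed simp

lemma poly_apply_smult:
  assumes T: "linear_op scale T"
  shows "poly_apply scale T (smult c f) v = c *s poly_apply scale T f v"
  by (induction f) (simp_all add: poly_apply_pCons[OF T] linear_opD(2)[OF T] scale_right_distrib)

lemma poly_apply_intertwine:
  assumes T: "linear_op scale T" and T': "linear_op scale T'" and B: "linear_op scale B" and c: "\<And>x. B (T x) = T' (B x)"
  shows "B (poly_apply scale T f v) = poly_apply scale T' f (B v)"
  by (induction f) (simp_all add: poly_apply_pCons[OF T] poly_apply_pCons[OF T'] linear_opD[OF B] c)

lemma linear_op_poly_apply:
  assumes T: "linear_op scale T"
  shows "linear_op scale (poly_apply scale T f)"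
proof -
  have "poly_apply scale T f (x + y) = poly_apply scale T f x + poly_apply scale T f y" for x y
    by (induction f) (simp_all add: poly_apply_pCons[OF T] linear_opD[OF T] scale_right_distrib algebra_simps)
  moreover have "poly_apply scale T f (c *s x) = c *s poly_apply scale T f x" for c x
    by (induction f) (simp_all add: poly_apply_pCons[OF T] linear_opD[OF T] scale_right_distrib mult.commute)
  ultimately show ?thesis by (simp add: linear_op_iff)
qed

lemma poly_apply_mult:
  assumes T: "linear_op scale T"
  shows "poly_apply scale T (f * g) v = poly_apply scale T f (poly_apply scale T g v)"
  by (induction f) (simp_all add: poly_apply_pCons[OF T] poly_apply_add[OF T] poly_apply_smult[OF T])

lemma module_poly_apply:
  assumes "linear_op scale T" shows "Modules.module (poly_apply scale T)"
  by unfold_locales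
    (simp_all add: poly_apply_add[OF assms] poly_apply_mult[OF assms] poly_apply_1[OF assms]
      linear_opD(1)[OF linear_op_poly_apply[OF assms]])

lemma poly_apply_pcompose:
  assumes T: "linear_op scale T"
  shows "poly_apply scale (poly_apply scale T g) f v = poly_apply scale T (f \<circ>\<^sub>p g) v"
  by (induction f)
    (simp_all add: poly_apply_pCons[OF linear_op_poly_apply[OF T]] pcompose_pCons poly_apply_add[OF T]
      poly_apply_const[OF T] poly_apply_mult[OF T])

lemma poly_apply_dvd:
  assumes "linear_op scale T" "f dvd g" "poly_apply scale T f v = 0" shows "poly_apply scale T g v = 0"
  using assms(2,3) linear_opD(3)[OF linear_op_poly_apply[OF assms(1)]]
  by (auto simp: dvd_def mult.commute[of f] poly_apply_mult[OF assms(1)])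

lemma poly_apply_diff:
  assumes T: "linear_op scale T"
  shows "poly_apply scale T (f - g) v = poly_apply scale T f v - poly_apply scale T g v"
  using poly_apply_add[OF T, of "f - g" g v] by (simp add: algebra_simps)

lemma presents_annihilates:
  assumes T: "linear_op scale T" and pr: "presents (poly_apply scale T) UNIV r v P"
    and dvd: "\<And>i. i < r \<Longrightarrow> P i dvd f"
  shows "poly_apply scale T f x = 0"
proof -
  obtain g where x: "x = (\<Sum>i<r. poly_apply scale T (g i) (v i))" using presents_represent[OF pr] .
  have "poly_apply scale T f x = (\<Sum>i<r. poly_apply scale T (f * g i) (v i))"
    unfolding x linear_opD(6)[OF linear_op_poly_apply[OF T]] by (simp add: poly_apply_mult[OF T])
  also have "\<dots> = 0" using pr dvd by (auto simp: presents_def)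
  finally show ?thesis .
qed

lemma presents_generator_annihilated:
  assumes T: "linear_op scale T" and pr: "presents (poly_apply scale T) UNIV r v P" and j: "j < r"
  shows "poly_apply scale T (P j) (v j) = 0"
proof -
  have "(\<Sum>i<r. poly_apply scale T (if i = j then P j else 0) (v i)) = 0"
    using pr by (auto simp: presents_def)
  moreover have "(\<Sum>i<r. poly_apply scale T (if i = j then P j else 0) (v i)) =
      (\<Sum>i<r. if i = j then poly_apply scale T (P j) (v j) else 0)"
    by (rule sum.cong) auto
  ultimately show ?thesis using j by simp
qed

text \<open>
  Sending each generator to its counterpart is well defined and injective since the two families of
  generators satisfy the same relations.
\<close>

lemma presents_same_imp_similar:
  assumes T: "linear_op scale T" and T': "linear_op scale T'"
    and pr: "presents (poly_apply scale T) UNIV r v P"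
    and pr': "presents (poly_apply scale T') UNIV r v' P"
  shows "\<exists>\<phi>. linear_op scale \<phi> \<and> bij \<phi> \<and> (\<forall>x. \<phi> (T x) = T' (\<phi> x)) \<and> (\<forall>i<r. \<phi> (v i) = v' i)"
proof -
  let ?s = "\<lambda>f. \<Sum>i<r. poly_apply scale T (f i) (v i)"
  let ?s' = "\<lambda>f. \<Sum>i<r. poly_apply scale T' (f i) (v' i)"
  have "\<forall>x. \<exists>f. x = ?s f" using pr by (auto simp: presents_def)
  then obtain c where c: "\<And>x. x = ?s (c x)" by metis
  have diff: "?s f - ?s g = ?s (\<lambda>i. f i - g i)" "?s' f - ?s' g = ?s' (\<lambda>i. f i - g i)" for f g
    by (simp_all add: poly_apply_diff[OF T] poly_apply_diff[OF T'] sum_subtractf)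
  have eq: "?s f = ?s g \<longleftrightarrow> ?s' f = ?s' g" for f g
  proof -
    have "?s f - ?s g = 0 \<longleftrightarrow> ?s' f - ?s' g = 0"
      unfolding diff presents_eq_0_iff[OF pr] presents_eq_0_iff[OF pr'] ..
    then show ?thesis by simp
  qed
  define \<phi> where "\<phi> = (\<lambda>x. ?s' (c x))"
  have \<phi>: "\<phi> (?s f) = ?s' f" for f using c[of "?s f"] eq[of f "c (?s f)"] unfolding \<phi>_def by metis
  have lin: "linear_op scale \<phi>"
    unfolding linear_op_iff
  proof (intro conjI allI)
    fix x y
    have "x + y = ?s (\<lambda>i. c x i + c y i)"
      by (subst (1) c[of x], subst (1) c[of y]) (simp add: poly_apply_add[OF T] sum.distrib)
    then have "\<phi> (x + y) = ?s' (\<lambda>i. c x i + c y i)" using \<phi> by metis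
    then show "\<phi> (x + y) = \<phi> x + \<phi> y" by (simp add: \<phi>_def poly_apply_add[OF T'] sum.distrib)
  next
    fix a x
    have "a *s x = ?s (\<lambda>i. smult a (c x i))"
      by (subst (1) c[of x]) (simp add: poly_apply_smult[OF T] scale_sum_right)
    then have "\<phi> (a *s x) = ?s' (\<lambda>i. smult a (c x i))" using \<phi> by metis
    then show "\<phi> (a *s x) = a *s \<phi> x" by (simp add: \<phi>_def poly_apply_smult[OF T'] scale_sum_right)
  qed
  have "inj \<phi>"
  proof (rule injI)
    fix x y assume "\<phi> x = \<phi> y"
    then show "x = y" using eq c unfolding \<phi>_def by metis
  qed
  moreover have "surj \<phi>"
    unfolding surj_def
  proof
    fix y
    obtain f where "y = ?s' f" using presents_represent[OF pr'] .
    then show "\<exists>x. y = \<phi> x" using \<phi>[of f] by metis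
  qed
  moreover have "\<phi> (T x) = T' (\<phi> x)" for x
  proof -
    have "T x = ?s (\<lambda>i. [:0, 1:] * c x i)"
      by (subst (1) c[of x]) (simp add: linear_opD[OF T] poly_apply_mult[OF T] poly_apply_X[OF T] del: mult_pCons_left)
    then have "\<phi> (T x) = ?s' (\<lambda>i. [:0, 1:] * c x i)" using \<phi> by metis
    then show ?thesis
      by (simp add: \<phi>_def linear_opD[OF T'] poly_apply_mult[OF T'] poly_apply_X[OF T'] del: mult_pCons_left)
  qed
  moreover have "\<phi> (v j) = v' j" if j: "j < r" for j
  proof -
    have "?s (\<lambda>i. if i = j then 1 else 0) = (\<Sum>i<r. if i = j then v j else 0)"
      by (rule sum.cong) (auto simp: poly_apply_1[OF T])
    moreover have "?s' (\<lambda>i. if i = j then 1 else 0) = (\<Sum>i<r. if i = j then v' j else 0)"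
      by (rule sum.cong) (auto simp: poly_apply_1[OF T'])
    ultimately show ?thesis using \<phi>[of "\<lambda>i. if i = j then 1 else 0"] j by simp
  qed
  ultimately show ?thesis using lin by (auto simp: bij_def)
qed

text \<open>
  Since \<open>h\<close> inverts \<open>g\<close> modulo every \<open>P i\<close>, the operators \<open>T\<close> and \<open>g(T)\<close> are polynomials in
  each other; so the same vectors generate for both, and a relation over \<open>g(T)\<close> is
  a relation over \<open>T\<close> with \<open>g\<close> substituted into the coefficients.
\<close>

lemma presents_change_generator:
  assumes T: "linear_op scale T" and pr: "presents (poly_apply scale T) UNIV r v P"
    and dvd: "\<And>i f. i < r \<Longrightarrow> P i dvd f \<circ>\<^sub>p g \<longleftrightarrow> Q i dvd f"
    and inv: "\<And>i. i < r \<Longrightarrow> P i dvd h \<circ>\<^sub>p g - [:0, 1:]"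
  shows "presents (poly_apply scale (poly_apply scale T g)) UNIV r v Q"
    and "poly_apply scale (poly_apply scale T g) h = T"
proof -
  have "poly_apply scale T (h \<circ>\<^sub>p g - [:0, 1:]) x = 0" for x
    by (rule presents_annihilates[OF T pr inv])
  then have "poly_apply scale T (h \<circ>\<^sub>p g) x = T x" for x
    by (simp only: poly_apply_diff[OF T] poly_apply_X[OF T] right_minus_eq)
  then show *: "poly_apply scale (poly_apply scale T g) h = T"
    by (auto simp: poly_apply_pcompose[OF T])
  show "presents (poly_apply scale (poly_apply scale T g)) UNIV r v Q"
    unfolding presents_def
  proof (intro conjI ballI allI)
    fix x
    obtain f where "x = (\<Sum>i<r. poly_apply scale T (f i) (v i))" using presents_represent[OF pr] .
    also have "\<dots> = (\<Sum>i<r. poly_apply scale (poly_apply scale T g) (f i \<circ>\<^sub>p h) (v i))"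
      unfolding poly_apply_pcompose[OF linear_op_poly_apply[OF T], symmetric] * ..
    finally show "\<exists>f. x = (\<Sum>i<r. poly_apply scale (poly_apply scale T g) (f i) (v i))"
      by (rule exI[of _ "\<lambda>i. f i \<circ>\<^sub>p h"])
  next
    fix f
    have "(\<Sum>i<r. poly_apply scale T (f i \<circ>\<^sub>p g) (v i)) = 0 \<longleftrightarrow> (\<forall>i<r. P i dvd f i \<circ>\<^sub>p g)"
      using pr by (auto simp: presents_def)
    then show "(\<Sum>i<r. poly_apply scale (poly_apply scale T g) (f i) (v i)) = 0 \<longleftrightarrow> (\<forall>i<r. Q i dvd f i)"
      using dvd by (simp add: poly_apply_pcompose[OF T])
  qed simp
qed

end

context finite_dimensional_vector_space
begin

lemma finite_length_module_poly_apply: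
  assumes T: "linear_op scale T" shows "finite_length_module (poly_apply scale T) dim"
proof -
  interpret M: Modules.module "poly_apply scale T" by (rule module_poly_apply[OF T])
  have sub: "subspace U" if "M.subspace U" for U
    using M.subspace_0[OF that] M.subspace_add[OF that] M.subspace_scale[OF that, of _ "[:_:]"]
    by (auto intro!: subspaceI simp: poly_apply_const[OF T])
  show ?thesis
  proof
    fix U W assume "M.subspace U" "M.subspace W" "U \<subset> W"
    then show "dim U < dim W" using dim_psubset sub by (metis span_eq_iff)
  qed
qed

lemma independent_family_le_dim:
  assumes "\<And>c. (\<Sum>i<m. c i *s u i) = 0 \<Longrightarrow> \<forall>i<m. c i = 0"
  shows "m \<le> dim UNIV"
proof -
  have inj: "inj_on u {..<m}"
  proof (rule inj_onI, rule ccontr)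
    fix i j assume ij: "i \<in> {..<m}" "j \<in> {..<m}" "u i = u j" "i \<noteq> j"
    let ?c = "\<lambda>l. (if l = i then 1 else 0) - (if l = j then 1 else 0 :: 'a)"
    have "(\<Sum>l<m. ?c l *s u l) = (\<Sum>l<m. (if l = i then u i else 0) - (if l = j then u j else 0))"
      by (rule sum.cong) (auto simp: scale_left_diff_distrib)
    also have "\<dots> = 0" using ij by (simp add: sum_subtractf)
    finally have "\<forall>l<m. ?c l = 0" by (rule assms)
    then have "?c i = 0" using ij(1) by blast
    then show False using ij by simp
  qed
  have "independent (u ` {..<m})"
  proof (rule independent_if_scalars_zero)
    fix f x assume f: "(\<Sum>x\<in>u ` {..<m}. f x *s x) = 0" and x: "x \<in> u ` {..<m}"
    have "(\<Sum>i<m. f (u i) *s u i) = 0" using f by (simp add: sum.reindex[OF inj])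
    then have "\<forall>i<m. f (u i) = 0" by (rule assms)
    then show "f x = 0" using x by blast
  qed simp
  then have "card (u ` {..<m}) \<le> dim UNIV" by (intro independent_card_le_dim) auto
  then show ?thesis by (simp add: card_image[OF inj])
qed

text \<open>
  The vectors \<open>X ^ j v i\<close> with \<open>j\<close> below the degree of \<open>P i\<close> are linearly independent, and so are
  the generators \<open>v i\<close>.
\<close>

lemma presents_bounds:
  assumes T: "linear_op scale T" and pr: "presents (poly_apply scale T) UNIV r v P"
  shows "i < r \<Longrightarrow> degree (P i) \<le> dim UNIV"
    and "(\<And>i. i < r \<Longrightarrow> degree (P i) > 0) \<Longrightarrow> r \<le> dim UNIV"
proof -
  have zero: "\<forall>i<r. P i dvd f i" if "(\<Sum>i<r. poly_apply scale T (f i) (v i)) = 0" for f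
    using that pr by (auto simp: presents_def)
  have pc: "poly_apply scale T (\<Sum>j\<in>A. g j) w = (\<Sum>j\<in>A. poly_apply scale T (g j) w)" for A g w
    by (induction A rule: infinite_finite_induct) (simp_all add: poly_apply_add[OF T])
  show "degree (P i) \<le> dim UNIV" if i: "i < r"
  proof (rule independent_family_le_dim)
    fix c :: "nat \<Rightarrow> 'a"
    let ?u = "\<lambda>j. poly_apply scale T (monom 1 j) (v i)"
    define f where "f = (\<Sum>j<degree (P i). monom (c j) j)"
    assume 0: "(\<Sum>j<degree (P i). c j *s ?u j) = 0"
    have "poly_apply scale T f (v i) = (\<Sum>j<degree (P i). c j *s ?u j)"
      unfolding f_def pc by (rule sum.cong) (simp_all add: poly_apply_smult[OF T, symmetric] smult_monom)
    then have f0: "poly_apply scale T f (v i) = 0" using 0 by simp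
    have "(\<Sum>l<r. poly_apply scale T (if l = i then f else 0) (v l)) = 0"
      by (rule sum.neutral) (simp add: f0)
    then have "P i dvd f" using zero[of "\<lambda>l. if l = i then f else 0"] i by auto
    have f: "f = 0"
    proof (rule ccontr)
      assume "f \<noteq> 0"
      then have "degree (P i) \<le> degree f" using \<open>P i dvd f\<close> by (rule dvd_imp_degree_le[rotated])
      moreover have "coeff f j = 0" if "degree (P i) \<le> j" for j
        using that by (auto simp: f_def coeff_sum intro!: sum.neutral)
      ultimately show False using \<open>f \<noteq> 0\<close> by (metis leading_coeff_0_iff)
    qed
    have "coeff f j = c j" if "j < degree (P i)" for j
      using that by (simp add: f_def coeff_sum)
    then show "\<forall>j<degree (P i). c j = 0" using f by simp
  qed
  show "r \<le> dim UNIV" if pos: "\<And>i. i < r \<Longrightarrow> degree (P i) > 0"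
  proof (rule independent_family_le_dim)
    fix c :: "nat \<Rightarrow> 'a"
    assume "(\<Sum>i<r. c i *s v i) = 0"
    then have "\<forall>i<r. P i dvd [:c i:]" using zero[of "\<lambda>i. [:c i:]"] by (simp add: poly_apply_const[OF T])
    then show "\<forall>i<r. c i = 0"
      using pos by (metis degree_pCons_0 dvd_imp_degree_le leD pCons_eq_0_iff)
  qed
qed

end

section \<open>The residue field of an irreducible polynomial\<close>

text \<open>
  Remainders stand for the residue classes, so that the carrier consists of polynomials and
  \<open>extension_representable\<close> applies.
\<close>

definition residue_field :: "'a::field poly \<Rightarrow> 'a poly ring" where
  "residue_field p = \<lparr>carrier = {f. degree f < degree p}, monoid.mult = (\<lambda>f g. f * g mod p),
     one = 1, ring.zero = 0, add = (+)\<rparr>"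

lemma residue_field_simps [simp]:
  "carrier (residue_field p) = {f. degree f < degree p}"
  "f \<otimes>\<^bsub>residue_field p\<^esub> g = f * g mod p"
  "f \<oplus>\<^bsub>residue_field p\<^esub> g = f + g"
  "\<one>\<^bsub>residue_field p\<^esub> = 1"
  "\<zero>\<^bsub>residue_field p\<^esub> = 0"
  by (simp_all add: residue_field_def)

lemma degree_mod_lt:
  fixes p :: "'a::field poly"
  assumes "degree p > 0" shows "degree (f mod p) < degree p"
  using assms degree_mod_less[of p f] by (cases "p = 0"; cases "f mod p = 0") auto

lemma field_residue_field:
  fixes p :: "'a::field poly"
  assumes p: "irreducible p" shows "field (residue_field p)"
proof -
  note d = irreducible_degree_pos[OF p]
  have ab: "abelian_group (residue_field p)"
  proof (rule abelian_groupI, goal_cases)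
    case (6 x)
    then show ?case by (intro bexI[of _ "- x"]) auto
  qed (use d in \<open>auto simp: algebra_simps degree_add_less\<close>)
  have cm: "Group.comm_monoid (residue_field p)"
    by (rule comm_monoidI)
      (use d in \<open>auto simp: degree_mod_lt mod_poly_less mod_mult_left_eq mod_mult_right_eq algebra_simps\<close>)
  have cr: "cring (residue_field p)"
    by (rule cringI[OF ab cm])
      (auto simp: poly_mod_add_left algebra_simps)
  then interpret cring "residue_field p" .
  show ?thesis
  proof (rule cring_fieldI, rule equalityI)
    show "Units (residue_field p) \<subseteq> carrier (residue_field p) - {\<zero>\<^bsub>residue_field p\<^esub>}"
      by (auto simp: Units_def)
    show "carrier (residue_field p) - {\<zero>\<^bsub>residue_field p\<^esub>} \<subseteq> Units (residue_field p)"
    proof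
      fix f assume "f \<in> carrier (residue_field p) - {\<zero>\<^bsub>residue_field p\<^esub>}"
      then have f: "degree f < degree p" "f \<noteq> 0" by auto
      then have "\<not> p dvd f" by (auto dest: dvd_imp_degree_le)
      then obtain a b where ab: "a * f + b * p = 1" using irreducible_bezout[OF p] by blast
      have "1 mod p = (a mod p) * f mod p" unfolding ab[symmetric] by (simp add: mod_mult_left_eq)
      then have "(a mod p) * f mod p = 1" using d by (simp add: mod_poly_less)
      then show "f \<in> Units (residue_field p)"
        using f d by (auto simp: Units_def mult.commute degree_mod_lt intro!: exI[of _ "a mod p"])
    qed
  qed
qed

lemma field_extension_residue_field:
  fixes p :: "'a::field poly"
  assumes p: "irreducible p" shows "field_extension (residue_field p) (\<lambda>a. [:a:])"
  using field_residue_field[OF p] irreducible_degree_pos[OF p]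
  by (auto simp: field_extension_def ring_hom_def ring_of_type_algebra_def mod_poly_less one_pCons)

text \<open>
  The subspaces of polynomials of degree less than \<open>d\<close> grow by one dimension at each step, by
  adjoining the monomial of degree \<open>d\<close>.
\<close>

lemma extension_degree_residue_field:
  fixes p :: "'a::field poly"
  assumes p: "irreducible p" and n: "Polynomial.degree p \<le> n"
  shows "extension_degree_le (residue_field p) (\<lambda>a. [:a:]) n"
proof -
  interpret field "residue_field p" by (rule field_residue_field[OF p])
  have "dimension d (range (\<lambda>a. [:a:])) {f. \<forall>i\<ge>d. poly.coeff f i = 0}" if "d \<le> Polynomial.degree p" for d
    using that
  proof (induction d)
    case 0
    have "{f. \<forall>i\<ge>0. poly.coeff f i = 0} = {\<zero>\<^bsub>residue_field p\<^esub>}" by (auto simp: poly_eq_iff)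
    then show ?case using zero_dim by simp
  next
    case (Suc d)
    let ?K = "range (\<lambda>a. [:a:])" and ?E = "{f. \<forall>i\<ge>d. poly.coeff f i = 0}"
    let ?v = "Polynomial.monom 1 d :: 'a poly"
    have v: "?v \<in> carrier (residue_field p)" "?v \<notin> ?E" using Suc.prems by (auto simp: degree_monom_eq)
    have mult: "Polynomial.smult a ?v mod p = Polynomial.monom a d" for a
      using Suc.prems by (simp add: smult_monom mod_poly_less le_less_trans[OF degree_monom_le])
    have "line_extension ?K ?v ?E = {f. \<forall>i\<ge>Suc d. poly.coeff f i = 0}"
    proof (rule Set.set_eqI)
      fix f :: "'a poly"
      have "f \<in> line_extension ?K ?v ?E \<longleftrightarrow> (\<exists>a. \<exists>e\<in>?E. f = Polynomial.monom a d + e)"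
        by (auto simp add: line_extension_mem_iff mult simp del: smult_monom)
      also have "\<dots> \<longleftrightarrow> (\<forall>i\<ge>Suc d. poly.coeff f i = 0)"
      proof
        assume f: "\<forall>i\<ge>Suc d. poly.coeff f i = 0"
        define e where "e = f - Polynomial.monom (poly.coeff f d) d"
        have "e \<in> ?E" using f by (force simp: e_def Suc_le_eq le_eq_less_or_eq[of d])
        moreover have "f = Polynomial.monom (poly.coeff f d) d + e" by (simp add: e_def)
        ultimately show "\<exists>a. \<exists>e\<in>?E. f = Polynomial.monom a d + e" by blast
      qed auto
      finally show "f \<in> line_extension ?K ?v ?E \<longleftrightarrow> f \<in> {f. \<forall>i\<ge>Suc d. poly.coeff f i = 0}" by simp
    qed
    then show ?case using Suc_dim[OF v Suc.IH] Suc.prems by simp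
  qed
  from this[of "Polynomial.degree p"] have "dimension (Polynomial.degree p) (range (\<lambda>a. [:a:])) {f. \<forall>i\<ge>Polynomial.degree p. poly.coeff f i = 0}"
    by simp
  moreover have "{f. \<forall>i\<ge>Polynomial.degree p. poly.coeff f i = 0} = carrier (residue_field p)"
  proof -
    have "Polynomial.degree f < Polynomial.degree p" if "\<forall>i\<ge>Polynomial.degree p. poly.coeff f i = 0" for f
      using that irreducible_degree_pos[OF p] by (metis degree_0 leading_coeff_0_iff not_le)
    then show ?thesis by (auto intro: coeff_eq_0)
  qed
  ultimately show ?thesis using n by (auto simp: extension_degree_le_def)
qed

text \<open>
  A homomorphism over the ground field is the substitution of the image \<open>g\<close> of the variable; \<open>h\<close> is a
  preimage of the variable.
\<close>

lemma residue_field_iso_imp_residue_iso: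
  fixes p q :: "'a::field poly"
  assumes p: "irreducible p" and q: "irreducible q"
    and iso: "extension_iso (residue_field q) (\<lambda>a. [:a:]) (residue_field p) (\<lambda>a. [:a:])"
  shows "\<exists>g h. residue_iso p q g h"
proof -
  note dp = irreducible_degree_pos[OF p] and dq = irreducible_degree_pos[OF q]
  obtain k where k: "k \<in> ring_iso (residue_field q) (residue_field p)" and kc: "\<And>a. k [:a:] = [:a:]"
    using iso by (auto simp: extension_iso_def)
  have k_mult: "k (f * g mod q) = k f * k g mod p" and k_add: "k (f + g) = k f + k g"
    if "degree f < degree q" "degree g < degree q" for f g
    using k that by (auto simp: ring_iso_def ring_hom_def)
  have bij: "bij_betw k {f. degree f < degree q} {f. degree f < degree p}"
    using k by (simp add: ring_iso_def)
  have k0: "k 0 = 0" using kc[of 0] by simp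
  define g where "g = k ([:0, 1:] mod q)"
  have kg: "k (f mod q) = (f \<circ>\<^sub>p g) mod p" for f
  proof (induction f)
    case (pCons a f)
    have "pCons a f mod q = [:a:] + ([:0, 1:] mod q) * (f mod q) mod q"
    proof -
      have "pCons a f mod q = ([:a:] + [:0, 1:] * f) mod q" by simp
      also have "\<dots> = [:a:] mod q + ([:0, 1:] mod q) * (f mod q) mod q"
        by (simp only: poly_mod_add_left mod_mult_eq)
      finally show ?thesis using dq by (simp only: mod_poly_less degree_pCons_0)
    qed
    then have "k (pCons a f mod q) = [:a:] + g * ((f \<circ>\<^sub>p g) mod p) mod p"
      using dq by (simp add: k_add k_mult degree_mod_lt kc g_def[symmetric] pCons.IH)
    also have "\<dots> = (pCons a f \<circ>\<^sub>p g) mod p"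
      using dp by (simp add: pcompose_pCons poly_mod_add_left mod_mult_right_eq mod_poly_less)
    finally show ?case .
  qed (simp add: k0)
  have "[:0, 1:] mod p \<in> k ` {f. degree f < degree q}"
    using bij degree_mod_lt[OF dp] by (auto simp: bij_betw_def)
  then obtain h where h: "degree h < degree q" "k h = [:0, 1:] mod p" by auto
  have hg: "p dvd h \<circ>\<^sub>p g - [:0, 1:]"
    using kg[of h] h by (metis mod_eq_dvd_iff mod_poly_less)
  have pq: "p dvd q \<circ>\<^sub>p g" using kg[of q] k0 by (simp add: dvd_eq_mod_eq_0)
  have "h \<circ>\<^sub>p g - [:0, 1:] dvd p \<circ>\<^sub>p (h \<circ>\<^sub>p g) - p \<circ>\<^sub>p [:0, 1:]" by (rule dvd_pcompose_diff)
  then have "p dvd p \<circ>\<^sub>p (h \<circ>\<^sub>p g) - p" using hg dvd_trans by auto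
  then have "p dvd (p \<circ>\<^sub>p h) \<circ>\<^sub>p g"
    using dvd_diff_imp_dvd_iff[of p "p \<circ>\<^sub>p (h \<circ>\<^sub>p g)" p] by (simp only: pcompose_assoc dvd_refl)
  then have "k ((p \<circ>\<^sub>p h) mod q) = k 0" unfolding kg k0 by (simp add: dvd_eq_mod_eq_0)
  then have "(p \<circ>\<^sub>p h) mod q = 0"
    by (rule inj_onD[OF bij_betw_imp_inj_on[OF bij]]) (use degree_mod_lt[OF dq] dq in simp_all)
  then have "q dvd p \<circ>\<^sub>p h" by (simp only: dvd_eq_mod_eq_0)
  then show ?thesis using hg pq unfolding residue_iso_def by blast
qed

text \<open>
  When the residue field of \<open>p\<close> has degree at most \<open>n\<close>, this is one of the classes that
  \<open>finitely_many_extensions_le\<close> counts.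
\<close>

definition residue_class :: "nat \<Rightarrow> 'a::field poly \<Rightarrow> ('a list ring \<times> ('a \<Rightarrow> 'a list)) set" where
  "residue_class n p = {E \<in> extensions_le n. extension_iso (residue_field p) (\<lambda>a. [:a:]) (fst E) (snd E)}"

lemma residue_class_in_quotient:
  fixes p :: "'a::field poly"
  assumes p: "irreducible p" and n: "degree p \<le> n"
  shows "residue_class n p \<in> extensions_le n // extension_iso_rel n"
proof -
  note ext = field_extension_residue_field[OF p]
  obtain E where E: "E \<in> extensions_le n" "extension_iso (residue_field p) (\<lambda>a. [:a:]) (fst E) (snd E)"
    using extension_representable[OF ext extension_degree_residue_field[OF p n]] by auto
  have fe: "field_extension (fst E') (snd E')" if "E' \<in> extensions_le n" for E' :: "'a list ring \<times> ('a \<Rightarrow> 'a list)"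
    using that by (auto simp: extensions_le_def)
  have "residue_class n p = extension_iso_rel n `` {E}"
  proof (intro Set.set_eqI)
    fix E' :: "'a list ring \<times> ('a \<Rightarrow> 'a list)"
    have "E' \<in> residue_class n p \<longleftrightarrow> E' \<in> extensions_le n \<and> extension_iso (fst E) (snd E) (fst E') (snd E')"
      using extension_iso_trans[OF extension_iso_sym[OF ext fe[OF E(1)] E(2)]]
        extension_iso_trans[OF E(2)] by (auto simp: residue_class_def)
    then show "E' \<in> residue_class n p \<longleftrightarrow> E' \<in> extension_iso_rel n `` {E}"
      using E(1) by (cases E; cases E') (auto simp: extension_iso_rel_def)
  qed
  then show ?thesis using E(1) by (auto simp: quotient_def)
qed

lemma residue_class_eq_imp_residue_iso:
  fixes p q :: "'a::field poly"
  assumes p: "irreducible p" "degree p \<le> n" and q: "irreducible q" 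
    and eq: "residue_class n p = residue_class n q"
  shows "\<exists>g h. residue_iso p q g h"
proof -
  have "residue_class n p \<noteq> {}"
    using in_quotient_imp_non_empty[OF equiv_extension_iso_rel residue_class_in_quotient[OF p]] .
  then obtain E where E: "E \<in> residue_class n p" "E \<in> residue_class n q" using eq by blast
  then have "field_extension (fst E) (snd E)" by (auto simp: residue_class_def extensions_le_def)
  then have "extension_iso (residue_field q) (\<lambda>a. [:a:]) (residue_field p) (\<lambda>a. [:a:])"
    using E extension_iso_trans extension_iso_sym[OF field_extension_residue_field[OF p(1)]]
    unfolding residue_class_def by blast
  then show ?thesis by (rule residue_field_iso_imp_residue_iso[OF p(1) q])
qed

section \<open>Centralizers of linear and affine maps\<close>

text \<open>
  For linear \<open>B\<close> and \<open>T\<close> this says that \<open>\<lambda>x. B x + w\<close> commutes with \<open>\<lambda>x. T x + u\<close>. With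
  \<open>w = 0\<close> and \<open>u = 0\<close> it also covers centralizers in the linear group.
\<close>

definition commutes :: "('v::ab_group_add \<Rightarrow> 'v) \<Rightarrow> 'v \<Rightarrow> ('v \<Rightarrow> 'v) \<Rightarrow> 'v \<Rightarrow> bool" where
  "commutes B w T u \<longleftrightarrow> (\<forall>x. B (T x) = T (B x)) \<and> B u + w = T w + u"

text \<open>
  The affine map \<open>\<lambda>x. T x + u\<close> with a primary cyclic decomposition of \<open>T\<close> in which \<open>u\<close>
  is zero (\<open>J = None\<close>) or a generator of a summand belonging to \<open>X - 1\<close> (\<open>J = Some j\<close>).
\<close>

definition normal_form ::
    "('a::field \<Rightarrow> 'v::ab_group_add \<Rightarrow> 'v) \<Rightarrow> ('v \<Rightarrow> 'v) \<Rightarrow> 'v \<Rightarrow> nat \<Rightarrow> (nat \<Rightarrow> 'v) \<Rightarrow> (nat \<Rightarrow> 'a poly) \<Rightarrow> (nat \<Rightarrow> nat) \<Rightarrow> nat option \<Rightarrow> bool" where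
  "normal_form scale T u r v p k J \<longleftrightarrow> linear_op scale T
     \<and> presents (poly_apply scale T) UNIV r v (\<lambda>i. p i ^ k i)
     \<and> (\<forall>i<r. irreducible (p i) \<and> lead_coeff (p i) = 1 \<and> k i > 0)
     \<and> (case J of None \<Rightarrow> u = 0 | Some j \<Rightarrow> j < r \<and> p j = [:- 1, 1:] \<and> u = v j)"

text \<open>
  The polynomials enter only through their residue fields, two flags, and the information which of
  them coincide; the latter is needed to substitute consistently in all summands.
  The flag for \<open>p i = [:- 1, 1:]\<close> marks the summands that can carry the translation part.
\<close>

definition invariant :: "nat \<Rightarrow> nat \<Rightarrow> (nat \<Rightarrow> 'a::field poly) \<Rightarrow> (nat \<Rightarrow> nat) \<Rightarrow> nat option \<Rightarrow>
    nat \<times> (('a list ring \<times> ('a \<Rightarrow> 'a list)) set \<times> bool \<times> bool \<times> nat) list \<times> (nat \<times> nat) set \<times> nat option" where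
  "invariant n r p k J =
     (r, map (\<lambda>i. (residue_class n (p i), pderiv (p i) = 0, p i = [:- 1, 1:], k i)) [0..<r],
      {(i, j). i < r \<and> j < r \<and> p i = p j}, J)"

context vector_space
begin

lemma affine_commute_iff:
  assumes B: "linear_op scale B" and T: "linear_op scale T"
  shows "(\<lambda>x. B x + w) \<circ> (\<lambda>x. T x + u) = (\<lambda>x. T x + u) \<circ> (\<lambda>x. B x + w) \<longleftrightarrow> commutes B w T u"
proof -
  have "(\<lambda>x. B x + w) \<circ> (\<lambda>x. T x + u) = (\<lambda>x. T x + u) \<circ> (\<lambda>x. B x + w) \<longleftrightarrow>
      (\<forall>x. B (T x) + (B u + w) = T (B x) + (T w + u))"
    by (simp add: fun_eq_iff linear_opD(1)[OF B] linear_opD(1)[OF T] add.assoc)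
  also have "\<dots> \<longleftrightarrow> commutes B w T u"
  proof
    assume *: "\<forall>x. B (T x) + (B u + w) = T (B x) + (T w + u)"
    have "B u + w = T w + u" using spec[OF *, of 0] by (simp add: linear_opD(3)[OF B] linear_opD(3)[OF T])
    then show "commutes B w T u" using * by (simp add: commutes_def)
  qed (simp add: commutes_def)
  finally show ?thesis .
qed

text \<open>
  Writing \<open>g = [:0, 1:] + e * [:- 1, 1:]\<close>, where \<open>e(T)\<close> kills \<open>u\<close>, commutation with
  \<open>\<lambda>x. T x + u\<close> says \<open>T w - w = B u - u\<close>, so \<open>e(T)\<close> kills \<open>T w - w\<close> as well and
  \<open>g(T) w = T w\<close>.
\<close>

lemma commutes_polynomial:
  assumes B: "linear_op scale B" and T: "linear_op scale T" and c: "commutes B w T u"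
    and g: "[:- 1, 1:] ^ Suc k dvd g - [:0, 1:]" and u: "poly_apply scale T ([:- 1, 1:] ^ k) u = 0"
  shows "commutes B w (poly_apply scale T g) u"
proof -
  have BT: "B (T x) = T (B x)" for x using c by (simp add: commutes_def)
  note comm = poly_apply_intertwine[OF T T B BT]
  obtain d where "g - [:0, 1:] = [:- 1, 1:] ^ Suc k * d" using g by blast
  then have gd: "g = [:0, 1:] + ([:- 1, 1:] ^ k * d) * [:- 1, 1:]"
    by (simp only: power_Suc mult_ac diff_eq_eq add.commute)
  define e where "e = [:- 1, 1:] ^ k * d"
  have e: "poly_apply scale T e u = 0"
    by (rule poly_apply_dvd[OF T _ u]) (simp add: e_def)
  have w: "T w - w = B u - u" using c by (simp add: commutes_def algebra_simps)
  have "poly_apply scale T [:- 1, 1:] w = T w - w"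
    by (simp add: poly_apply_pCons[OF T] linear_opD[OF T])
  then have "poly_apply scale T g w = T w + poly_apply scale T e (T w - w)"
    unfolding gd e_def[symmetric]
    by (simp only: poly_apply_add[OF T] poly_apply_mult[OF T] poly_apply_X[OF T])
  also have "poly_apply scale T e (T w - w) = B (poly_apply scale T e u) - poly_apply scale T e u"
    unfolding w by (simp add: linear_opD(5)[OF linear_op_poly_apply[OF T]] comm)
  finally have "poly_apply scale T g w = T w" by (simp add: e linear_opD(3)[OF B])
  then show ?thesis using c comm by (simp add: commutes_def)
qed

lemma commutes_transport:
  assumes \<phi>: "linear_op scale \<phi>" "bij \<phi>" and S: "\<And>x. \<phi> (S x) = T (\<phi> x)"
  shows "commutes B w S u \<longleftrightarrow> commutes (\<phi> \<circ> B \<circ> inv_into UNIV \<phi>) (\<phi> w) T (\<phi> u)"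
proof -
  have inv: "inv_into UNIV \<phi> (\<phi> x) = x" "\<phi> (inv_into UNIV \<phi> y) = y" for x y
    using \<phi>(2) by (simp_all add: bij_is_inj bij_is_surj surj_f_inv_f)
  have T: "T y = \<phi> (S (inv_into UNIV \<phi> y))" for y by (simp add: S inv)
  have inj: "\<phi> x = \<phi> y \<longleftrightarrow> x = y" for x y using \<phi>(2) by (metis inv(1))
  have "(\<forall>y. \<phi> (B (S (inv_into UNIV \<phi> y))) = \<phi> (S (B (inv_into UNIV \<phi> y)))) \<longleftrightarrow> (\<forall>x. B (S x) = S (B x))"
    unfolding inj by (metis inv(1))
  then show ?thesis
    unfolding commutes_def T by (simp add: inv linear_opD(1)[OF \<phi>(1), symmetric] inj)
qed

text \<open>
  A single \<open>g\<close> is congruent, modulo a high power of each \<open>p i\<close>, to a substitution that lifts the residue isomorphism with \<open>q i\<close>.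
  The Chinese remainder theorem applies because the substitution can be chosen as a function of \<open>p i\<close>: equal
  \<open>p i\<close> have equal \<open>q i\<close>. The inverse \<open>h\<close> is glued in the same way as a function of \<open>q i\<close>.
  The modulus \<open>X - 1\<close> is always included, with the identical substitution, to
  control the translation part of affine maps.
\<close>

lemma exists_matching_generator:
  fixes p q :: "nat \<Rightarrow> 'a poly"
  assumes p: "\<And>i. i < r \<Longrightarrow> irreducible (p i) \<and> lead_coeff (p i) = 1"
    and q: "\<And>i. i < r \<Longrightarrow> irreducible (q i) \<and> lead_coeff (q i) = 1"
    and iso: "\<And>i. i < r \<Longrightarrow> \<exists>g h. residue_iso (p i) (q i) g h"
    and insep: "\<And>i. i < r \<Longrightarrow> pderiv (p i) = 0 \<longleftrightarrow> pderiv (q i) = 0"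
    and pat: "\<And>i j. i < r \<Longrightarrow> j < r \<Longrightarrow> p i = p j \<longleftrightarrow> q i = q j"
    and one: "\<And>i. i < r \<Longrightarrow> p i = [:- 1, 1:] \<longleftrightarrow> q i = [:- 1, 1:]"
    and K: "2 \<le> K"
  shows "\<exists>g h. (\<forall>i<r. lifts_to (p i) (q i) g \<and> p i ^ K dvd h \<circ>\<^sub>p g - [:0, 1:])
    \<and> [:- 1, 1:] ^ K dvd g - [:0, 1:] \<and> [:- 1, 1:] ^ K dvd h - [:0, 1:]"
proof -
  let ?x = "[:0, 1 :: 'a:]" and ?l = "[:- 1, 1 :: 'a:]"
  have l: "irreducible ?l" "lead_coeff ?l = 1" by (simp_all add: irreducible_linear_field_poly)
  have "\<exists>c. \<forall>i<r. lifts_to (p i) (q i) (c (p i)) \<and> (p i = ?l \<longrightarrow> c (p i) = ?x)"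
  proof -
    have "\<exists>g. \<forall>i<r. p i = P \<longrightarrow> lifts_to P (q i) g \<and> (P = ?l \<longrightarrow> g = ?x)" for P
    proof (cases "\<exists>i<r. p i = P")
      case True
      then obtain i where i: "i < r" "p i = P" by blast
      have "\<exists>g. lifts_to P (q i) g \<and> (P = ?l \<longrightarrow> g = ?x)"
      proof (cases "P = ?l")
        case True
        then have "q i = ?l" using one i by blast
        moreover have "\<not> ?l\<^sup>2 dvd ?l"
        proof
          assume "?l\<^sup>2 dvd ?l"
          then have "degree (?l\<^sup>2) \<le> degree ?l" by (rule dvd_imp_degree_le) simp
          then show False by (simp add: degree_power_eq)
        qed
        moreover have "\<exists>h. ?l dvd h \<circ>\<^sub>p ?x - ?x" by (rule exI[of _ ?x]) simp
        ultimately have "lifts_to P (q i) ?x" unfolding lifts_to_def True by auto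
        then show ?thesis by blast
      next
        case False
        have "pderiv (q i) = 0 \<Longrightarrow> pderiv (p i) = 0" using insep i by blast
        then show ?thesis using residue_iso_lifts_to iso p q i False by metis
      qed
      moreover have "q j = q i" if "j < r" "p j = P" for j using pat that i by metis
      ultimately show ?thesis by metis
    qed blast
    then have "\<exists>c. \<forall>P. \<forall>i<r. p i = P \<longrightarrow> lifts_to P (q i) (c P) \<and> (P = ?l \<longrightarrow> c P = ?x)"
      by (intro choice allI)
    then show ?thesis by blast
  qed
  then obtain c where c: "\<And>i. i < r \<Longrightarrow> lifts_to (p i) (q i) (c (p i))"
    and cl: "\<And>i. i < r \<Longrightarrow> p i = ?l \<Longrightarrow> c (p i) = ?x" by blast
  define c' where "c' = c(?l := ?x)"
  have c': "lifts_to (p i) (q i) (c' (p i))" if "i < r" for i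
    using c[OF that] cl[OF that] by (auto simp: c'_def)
  have "\<exists>g. \<forall>P\<in>insert ?l (p ` {..<r}). P ^ K dvd g - c' P"
    by (rule chinese_remainder_irreducible_powers) (use p l in auto)
  then obtain g where g: "\<And>i. i < r \<Longrightarrow> p i ^ K dvd g - c' (p i)" "?l ^ K dvd g - ?x"
    by (auto simp: c'_def)
  have lift: "lifts_to (p i) (q i) g" if "i < r" for i
  proof -
    have "p i ^ 2 dvd g - c' (p i)" using g(1)[OF that] K by (rule power_le_dvd[rotated -1, rotated])
    then show ?thesis by (rule lifts_to_cong[OF c'[OF that]])
  qed
  have "\<exists>d. \<forall>Q. \<forall>i<r. q i = Q \<longrightarrow> p i ^ K dvd d Q \<circ>\<^sub>p g - ?x"
  proof (intro choice allI)
    fix Q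
    show "\<exists>d. \<forall>i<r. q i = Q \<longrightarrow> p i ^ K dvd d \<circ>\<^sub>p g - ?x"
    proof (cases "\<exists>i<r. q i = Q")
      case True
      then obtain i where i: "i < r" "q i = Q" by blast
      then obtain d where "p i ^ K dvd d \<circ>\<^sub>p g - ?x" using lifts_to_inverse lift p q by metis
      moreover have "p j = p i" if "j < r" "q j = Q" for j using pat that i by metis
      ultimately show ?thesis by metis
    qed blast
  qed
  then obtain d where d: "\<And>i. i < r \<Longrightarrow> p i ^ K dvd d (q i) \<circ>\<^sub>p g - ?x" by blast
  define d' where "d' = d(?l := ?x)"
  have d': "p i ^ K dvd d' (q i) \<circ>\<^sub>p g - ?x" if "i < r" for i
    using d[OF that] g(2) one[OF that] by (auto simp: d'_def)
  have "\<exists>h. \<forall>Q\<in>insert ?l (q ` {..<r}). Q ^ K dvd h - d' Q"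
    by (rule chinese_remainder_irreducible_powers) (use q l in auto)
  then obtain h where h: "\<And>i. i < r \<Longrightarrow> q i ^ K dvd h - d' (q i)" "?l ^ K dvd h - ?x"
    by (auto simp: d'_def)
  have "p i ^ K dvd h \<circ>\<^sub>p g - ?x" if i: "i < r" for i
  proof (rule dvd_diff_trans[OF _ d'[OF i]])
    have "p i ^ K dvd (h - d' (q i)) \<circ>\<^sub>p g"
      using lifts_to_power_dvd_iff lift[OF i] p[OF i] q[OF i] h(1)[OF i] by blast
    then show "p i ^ K dvd h \<circ>\<^sub>p g - d' (q i) \<circ>\<^sub>p g" by (simp add: pcompose_diff)
  qed
  then show ?thesis using lift g(2) h(2) by blast
qed

lemma normal_form_translation_killed:
  assumes "normal_form scale T u r v p k J" "\<forall>i<r. k i \<le> m"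
  shows "poly_apply scale T ([:- 1, 1:] ^ m) u = 0"
proof -
  have T: "linear_op scale T" using assms(1) by (simp add: normal_form_def)
  show ?thesis
  proof (cases J)
    case None
    then show ?thesis using assms(1) linear_opD(3)[OF linear_op_poly_apply[OF T]] by (simp add: normal_form_def)
  next
    case (Some j)
    then have j: "j < r" "p j = [:- 1, 1:]" "u = v j"
      and pr: "presents (poly_apply scale T) UNIV r v (\<lambda>i. p i ^ k i)"
      using assms(1) by (auto simp: normal_form_def)
    have "poly_apply scale T ([:- 1, 1:] ^ k j) u = 0"
      using presents_generator_annihilated[OF T pr j(1)] j by simp
    then show ?thesis by (rule poly_apply_dvd[OF T, rotated]) (use assms(2) j in \<open>simp add: le_imp_power_dvd\<close>)
  qed
qed

text \<open>
  The operator \<open>S = g(T)\<close> lies between \<open>T\<close> and \<open>T'\<close>: the pairs \<open>(T, u)\<close> and \<open>(S, u)\<close> commute with the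
  same affine maps because \<open>S\<close> and \<open>T\<close> are polynomials in each other, and \<open>(S, u)\<close> is carried to
  \<open>(T', u')\<close> by a linear bijection because \<open>S\<close> and \<open>T'\<close> have the same cyclic decomposition.
\<close>

lemma same_invariant_imp_same_commutation:
  assumes nf: "normal_form scale T u r v p k J" and nf': "normal_form scale T' u' r' v' p' k' J'"
    and deg: "\<And>i. i < r \<Longrightarrow> degree (p i) \<le> n"
    and eq: "invariant n r p k J = invariant n r' p' k' J'"
  shows "\<exists>\<phi>. linear_op scale \<phi> \<and> bij \<phi> \<and> (\<forall>B w. linear_op scale B \<longrightarrow>
    (commutes B w T u \<longleftrightarrow> commutes (\<phi> \<circ> B \<circ> inv_into UNIV \<phi>) (\<phi> w) T' u'))"
proof -
  have r': "r' = r" and J': "J' = J" using eq by (simp_all add: invariant_def)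
  have "map (\<lambda>i. (residue_class n (p i), pderiv (p i) = 0, p i = [:- 1, 1:], k i)) [0..<r]
      = map (\<lambda>i. (residue_class n (p' i), pderiv (p' i) = 0, p' i = [:- 1, 1:], k' i)) [0..<r]"
    using eq unfolding invariant_def r' by simp
  then have e: "residue_class n (p i) = residue_class n (p' i)" "pderiv (p i) = 0 \<longleftrightarrow> pderiv (p' i) = 0"
      "p i = [:- 1, 1:] \<longleftrightarrow> p' i = [:- 1, 1:]" "k i = k' i" if "i < r" for i
    using that by auto
  have "{(i, j). i < r \<and> j < r \<and> p i = p j} = {(i, j). i < r \<and> j < r \<and> p' i = p' j}"
    using eq unfolding invariant_def r' by simp
  then have pat: "p i = p j \<longleftrightarrow> p' i = p' j" if "i < r" "j < r" for i j using that by blast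
  have T: "linear_op scale T" "linear_op scale T'" and
    pr: "presents (poly_apply scale T) UNIV r v (\<lambda>i. p i ^ k i)" and
    pr': "presents (poly_apply scale T') UNIV r v' (\<lambda>i. p' i ^ k' i)" and
    p: "\<And>i. i < r \<Longrightarrow> irreducible (p i) \<and> lead_coeff (p i) = 1" and
    p': "\<And>i. i < r \<Longrightarrow> irreducible (p' i) \<and> lead_coeff (p' i) = 1"
    using nf nf' by (auto simp: normal_form_def r')
  have iso: "\<exists>g h. residue_iso (p i) (p' i) g h" if "i < r" for i
    using residue_class_eq_imp_residue_iso[OF _ deg[OF that] _ e(1)[OF that]] p[OF that] p'[OF that] by blast
  \<comment> \<open>Any common bound of the exponents serves, and being positive it makes \<open>Suc m\<close> at least \<open>2\<close>.\<close>
  define m where "m = Suc (\<Sum>i<r. k i)"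
  have km: "k i \<le> m" if "i < r" for i
    using member_le_sum[of i "{..<r}" k] that by (simp add: m_def)
  have "\<exists>g h. (\<forall>i<r. lifts_to (p i) (p' i) g \<and> p i ^ Suc m dvd h \<circ>\<^sub>p g - [:0, 1:])
    \<and> [:- 1, 1:] ^ Suc m dvd g - [:0, 1:] \<and> [:- 1, 1:] ^ Suc m dvd h - [:0, 1:]"
    by (rule exists_matching_generator[OF p p' iso e(2) pat e(3)]) (simp_all add: m_def)
  then obtain g h where lift: "\<And>i. i < r \<Longrightarrow> lifts_to (p i) (p' i) g"
    and inv: "\<And>i. i < r \<Longrightarrow> p i ^ Suc m dvd h \<circ>\<^sub>p g - [:0, 1:]"
    and g1: "[:- 1, 1:] ^ Suc m dvd g - [:0, 1:]" and h1: "[:- 1, 1:] ^ Suc m dvd h - [:0, 1:]"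
    by blast
  define S where "S = poly_apply scale T g"
  have S: "linear_op scale S" unfolding S_def by (rule linear_op_poly_apply[OF T(1)])
  have dvd: "p i ^ k i dvd f \<circ>\<^sub>p g \<longleftrightarrow> p' i ^ k' i dvd f" if "i < r" for i f
    using lifts_to_power_dvd_iff[OF _ _ lift[OF that]] p[OF that] p'[OF that] e(4)[OF that] by simp
  have inv': "p i ^ k i dvd h \<circ>\<^sub>p g - [:0, 1:]" if "i < r" for i
    using inv[OF that] km[OF that] by (meson dvd_trans le_SucI le_imp_power_dvd)
  have prS: "presents (poly_apply scale S) UNIV r v (\<lambda>i. p' i ^ k' i)"
    unfolding S_def by (rule presents_change_generator(1)[OF T(1) pr dvd inv'])
  have hS: "poly_apply scale S h = T"
    unfolding S_def by (rule presents_change_generator(2)[OF T(1) pr dvd inv'])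
  obtain \<phi> where \<phi>: "linear_op scale \<phi>" "bij \<phi>" "\<And>x. \<phi> (S x) = T' (\<phi> x)" "\<And>i. i < r \<Longrightarrow> \<phi> (v i) = v' i"
    using presents_same_imp_similar[OF S T(2) prS pr'] by blast
  have nfS: "normal_form scale S u r v p' k' J"
    using nf S prS p' e(3) e(4) by (auto simp: normal_form_def split: option.splits)
  have u': "\<phi> u = u'"
    using nf nf' \<phi>(4) linear_opD(3)[OF \<phi>(1)] by (auto simp: normal_form_def J' split: option.splits)
  have "commutes B w T u \<longleftrightarrow> commutes (\<phi> \<circ> B \<circ> inv_into UNIV \<phi>) (\<phi> w) T' u'" if B: "linear_op scale B" for B w
  proof -
    have uT: "poly_apply scale T ([:- 1, 1:] ^ m) u = 0"
      by (rule normal_form_translation_killed[OF nf]) (use km in blast)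
    have uS: "poly_apply scale S ([:- 1, 1:] ^ m) u = 0"
      by (rule normal_form_translation_killed[OF nfS]) (use km e(4) in auto)
    have "commutes B w T u \<longleftrightarrow> commutes B w S u"
      using commutes_polynomial[OF B T(1) _ g1 uT, folded S_def]
        commutes_polynomial[OF B S _ h1 uS, unfolded hS] by blast
    also have "\<dots> \<longleftrightarrow> commutes (\<phi> \<circ> B \<circ> inv_into UNIV \<phi>) (\<phi> w) T' (\<phi> u)"
      by (rule commutes_transport[where S = S and T = T' and \<phi> = \<phi>, OF \<phi>(1-3)])
    finally show ?thesis by (simp only: u')
  qed
  then show ?thesis using \<phi>(1,2) by blast
qed

text \<open>
  The combination that replaces \<open>v j\<close> involves \<open>v j\<close> itself, so the change of generators is invertible,
  and it is killed by \<open>P j\<close>, so the relations stay the same.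
\<close>

lemma presents_replace_generator:
  assumes T: "linear_op scale T" and pr: "presents (poly_apply scale T) UNIV r v P"
    and j: "j < r" "c j \<noteq> 0" and dvd: "\<And>i. i < r \<Longrightarrow> c i \<noteq> 0 \<Longrightarrow> P i dvd P j"
  shows "presents (poly_apply scale T) UNIV r (v(j := \<Sum>i<r. c i *s v i)) P"
proof -
  let ?v = "v(j := \<Sum>i<r. c i *s v i)"
  let ?h = "\<lambda>f i. (if i = j then 0 else f i) + [:c i:] * f j"
  have sum: "(\<Sum>i<r. poly_apply scale T (f i) (?v i)) = (\<Sum>i<r. poly_apply scale T (?h f i) (v i))" for f
  proof -
    have "(\<Sum>i<r. poly_apply scale T (f i) (?v i)) =
        (\<Sum>i<r. poly_apply scale T (if i = j then 0 else f i) (v i)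
          + (if i = j then poly_apply scale T (f j) (\<Sum>i<r. c i *s v i) else 0))"
      by (rule sum.cong) auto
    also have "\<dots> = (\<Sum>i<r. poly_apply scale T (if i = j then 0 else f i) (v i))
        + poly_apply scale T (f j) (\<Sum>i<r. c i *s v i)"
      using j(1) by (simp add: sum.distrib)
    also have "poly_apply scale T (f j) (\<Sum>i<r. c i *s v i) = (\<Sum>i<r. poly_apply scale T ([:c i:] * f j) (v i))"
      by (simp add: linear_opD(6)[OF linear_op_poly_apply[OF T]] linear_opD(2)[OF linear_op_poly_apply[OF T]] poly_apply_smult[OF T])
    finally show ?thesis by (simp only: poly_apply_add[OF T] sum.distrib)
  qed
  show ?thesis
    unfolding presents_def sum
  proof (intro conjI ballI allI)
    fix x
    obtain f where x: "x = (\<Sum>i<r. poly_apply scale T (f i) (v i))" using presents_represent[OF pr] .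
    define t where "t = smult (inverse (c j)) (f j)"
    define f' where "f' = (\<lambda>i. if i = j then t else f i - [:c i:] * t)"
    have "?h f' i = f i" for i using j(2) by (simp add: f'_def t_def)
    then have "x = (\<Sum>i<r. poly_apply scale T (?h f' i) (v i))" by (simp only: x)
    then show "\<exists>f. x = (\<Sum>i<r. poly_apply scale T (?h f i) (v i))"
      by (rule exI[where x = f'])
  next
    fix f
    have "(\<forall>i<r. P i dvd ?h f i) \<longleftrightarrow> (\<forall>i<r. P i dvd f i)"
    proof -
      have *: "P j dvd ?h f j \<longleftrightarrow> P j dvd f j" using j(2) by (simp add: dvd_smult_iff)
      have "P i dvd ?h f i \<longleftrightarrow> P i dvd f i" if i: "i < r" and "P j dvd f j" for i
      proof (cases "i = j")
        case False
        have "P i dvd [:c i:] * f j"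
          using dvd[OF i] that(2) by (cases "c i = 0") (auto intro: dvd_smult dvd_trans)
        then show ?thesis using False by (simp add: dvd_add_left_iff)
      qed (use * in simp)
      then show ?thesis using * j(1) by blast
    qed
    then show "(\<Sum>i<r. poly_apply scale T (?h f i) (v i)) = 0 \<longleftrightarrow> (\<forall>i<r. P i dvd f i)"
      unfolding presents_eq_0_iff[OF pr] .
  qed simp
qed

text \<open>
  Moving the origin changes the translation part by an element of the image of \<open>T - 1\<close>. Modulo this image
  every summand with \<open>p i \<noteq> X - 1\<close> vanishes, and in the others a multiple \<open>f(T) (v i)\<close> reduces to the scalar
  multiple by \<open>f(1)\<close>. The resulting combination \<open>u\<close> of generators can itself be made a generator, in place of one of
  largest order that occurs in it.
\<close>

lemma exists_normal_form:
  assumes T: "linear_op scale T" and pr: "presents (poly_apply scale T) UNIV r v (\<lambda>i. p i ^ k i)"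
    and p: "\<And>i. i < r \<Longrightarrow> irreducible (p i) \<and> lead_coeff (p i) = 1 \<and> k i > 0"
  shows "\<exists>o' u v' J. s = o' - T o' + u \<and> normal_form scale T u r v' p k J"
proof -
  obtain f where s: "s = (\<Sum>i<r. poly_apply scale T (f i) (v i))" using presents_represent[OF pr] .
  have lapp: "poly_apply scale T [:- 1, 1:] x = T x - x" for x
    by (simp add: poly_apply_pCons[OF T] linear_opD[OF T])
  have "\<exists>a y. poly_apply scale T (f i) (v i) = a *s v i + (y - T y) \<and> (a \<noteq> 0 \<longrightarrow> p i = [:- 1, 1:])"
    if i: "i < r" for i
  proof (cases "p i = [:- 1, 1:]")
    case True
    have "[:- 1, 1:] dvd f i - [:poly (f i) 1:]" by (simp add: poly_eq_0_iff_dvd[symmetric] dvd_iff_poly_eq_0)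
    then obtain d where "f i - [:poly (f i) 1:] = [:- 1, 1:] * d" by blast
    then have "f i = [:poly (f i) 1:] + [:- 1, 1:] * d" by (metis add.commute diff_add_cancel)
    then have "poly_apply scale T (f i) (v i) = poly_apply scale T ([:poly (f i) 1:] + [:- 1, 1:] * d) (v i)"
      by (rule arg_cong)
    also have "\<dots> = poly (f i) 1 *s v i + (T (poly_apply scale T d (v i)) - poly_apply scale T d (v i))"
      by (simp only: poly_apply_add[OF T] poly_apply_mult[OF T] lapp poly_apply_const[OF T])
    also have "\<dots> = poly (f i) 1 *s v i + (- poly_apply scale T d (v i) - T (- poly_apply scale T d (v i)))"
      by (simp add: linear_opD(4)[OF T])
    finally show ?thesis using True by blast
  next
    case False
    have "\<not> p i dvd [:- 1, 1:]"
      using monic_irreducible_dvd_imp_eq[of "p i" "[:- 1, 1:]"] p[OF i] False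
      by (auto simp: irreducible_linear_field_poly)
    then obtain a b where ab: "a * [:- 1, 1:] + b * p i ^ k i = 1"
      using irreducible_bezout_power p[OF i] by blast
    define y where "y = poly_apply scale T (f i * a) (v i)"
    have "poly_apply scale T (f i) (v i) = poly_apply scale T (f i * (a * [:- 1, 1:] + b * p i ^ k i)) (v i)"
      by (simp only: ab mult_1_right)
    also have "f i * (a * [:- 1, 1:] + b * p i ^ k i) = [:- 1, 1:] * (f i * a) + (f i * b) * p i ^ k i"
      by (simp only: distrib_left mult_ac)
    also have "poly_apply scale T \<dots> (v i) = T y - y"
      by (simp only: poly_apply_add[OF T] poly_apply_mult[OF T, of "[:- 1, 1:]"] lapp y_def
          poly_apply_mult[OF T, of "f i * b"] presents_generator_annihilated[OF T pr i]
          linear_opD(3)[OF linear_op_poly_apply[OF T]] add_0_right)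
    also have "\<dots> = 0 *s v i + (- y - T (- y))" by (simp add: linear_opD(4)[OF T])
    finally show ?thesis by blast
  qed
  then obtain a y where ay: "\<And>i. i < r \<Longrightarrow> poly_apply scale T (f i) (v i) = a i *s v i + (y i - T (y i))"
    and a: "\<And>i. i < r \<Longrightarrow> a i \<noteq> 0 \<Longrightarrow> p i = [:- 1, 1:]" by metis
  define o' where "o' = (\<Sum>i<r. y i)"
  have s': "s = o' - T o' + (\<Sum>i<r. a i *s v i)"
    unfolding s o'_def by (simp add: ay linear_opD(6)[OF T] sum.distrib sum_subtractf)
  show ?thesis
  proof (cases "\<forall>i<r. a i = 0")
    case True
    then have "normal_form scale T 0 r v p k None" using T pr p by (simp add: normal_form_def)
    moreover have "s = o' - T o' + 0" using s' True by simp
    ultimately show ?thesis by blast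
  next
    case False
    define A where "A = {i. i < r \<and> a i \<noteq> 0}"
    have A: "finite A" "A \<noteq> {}" using False by (auto simp: A_def)
    then have "Max (k ` A) \<in> k ` A" by (intro Max_in) auto
    then obtain j where j: "j \<in> A" "k j = Max (k ` A)" by auto
    have jmax: "k i \<le> k j" if "i \<in> A" for i using that A(1) j(2) by simp
    have jr: "j < r" "a j \<noteq> 0" using j(1) by (auto simp: A_def)
    have "presents (poly_apply scale T) UNIV r (v(j := \<Sum>i<r. a i *s v i)) (\<lambda>i. p i ^ k i)"
    proof (rule presents_replace_generator[where c = a and j = j, OF T pr jr])
      fix i assume i: "i < r" "a i \<noteq> 0"
      then have "p i = p j" using a jr by metis
      then show "p i ^ k i dvd p j ^ k j" using jmax i by (simp add: A_def le_imp_power_dvd)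
    qed
    then have "normal_form scale T (\<Sum>i<r. a i *s v i) r (v(j := \<Sum>i<r. a i *s v i)) p k (Some j)"
      using T p jr a by (simp add: normal_form_def)
    then show ?thesis using s' by blast
  qed
qed

end

section \<open>Finiteness\<close>

text \<open>
  The invariant is a relation \<open>P\<close> because the normal forms that define it are not unique.
\<close>

lemma finite_quotient_by_invariant:
  assumes R: "equiv A R" and "finite I" and ex: "\<And>x. x \<in> A \<Longrightarrow> \<exists>i\<in>I. P x i"
    and same: "\<And>x y i. x \<in> A \<Longrightarrow> y \<in> A \<Longrightarrow> P x i \<Longrightarrow> P y i \<Longrightarrow> (x, y) \<in> R"
  shows "finite (A // R)"
proof -
  define rep where "rep = (\<lambda>i. SOME x. x \<in> A \<and> P x i)"
  have "A // R \<subseteq> (\<lambda>i. R `` {rep i}) ` I"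
  proof
    fix C assume "C \<in> A // R"
    then obtain x where x: "x \<in> A" "C = R `` {x}" by (auto simp: quotient_def)
    then obtain i where i: "i \<in> I" "P x i" using ex by blast
    have "rep i \<in> A \<and> P (rep i) i" unfolding rep_def by (rule someI[of _ x]) (use x i in blast)
    then have "C = R `` {rep i}" using same x i equiv_class_eq[OF R] by blast
    then show "C \<in> (\<lambda>i. R `` {rep i}) ` I" using i by blast
  qed
  then show ?thesis using \<open>finite I\<close> finite_surj by blast
qed

text \<open>
  Conjugation by \<open>g\<close> maps the one centralizer onto the other.
\<close>

lemma (in monoid) z_equivI:
  assumes S: "S \<in> carrier G" and T: "T \<in> carrier G" and g: "g \<in> Units G"
    and iff: "\<And>f. f \<in> Units G \<Longrightarrow> f \<otimes> S = S \<otimes> f \<longleftrightarrow> (g \<otimes> f \<otimes> inv g) \<otimes> T = T \<otimes> (g \<otimes> f \<otimes> inv g)"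
  shows "(S, T) \<in> z_equiv_rel G"
proof -
  have cl: "f \<in> Units G \<Longrightarrow> g \<otimes> f \<otimes> inv g \<in> Units G" for f using g by simp
  have "g <#\<^bsub>units_of G\<^esub> (centralizer G S #>\<^bsub>units_of G\<^esub> inv\<^bsub>units_of G\<^esub> g)
      = (\<lambda>f. g \<otimes> f \<otimes> inv g) ` centralizer G S"
    using g by (force simp: l_coset_def r_coset_def units_of_mult units_of_inv mem_centralizer_iff[OF S]
        m_assoc Units_closed)
  also have "\<dots> = centralizer G T"
  proof (intro equalityI subsetI)
    fix h assume "h \<in> (\<lambda>f. g \<otimes> f \<otimes> inv g) ` centralizer G S"
    then show "h \<in> centralizer G T"
      using cl iff by (auto simp: mem_centralizer_iff S T)
  next
    fix h assume h: "h \<in> centralizer G T"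
    then have hu: "h \<in> Units G" by (simp add: mem_centralizer_iff T)
    define f where "f = inv g \<otimes> h \<otimes> g"
    have f: "f \<in> Units G" using hu g by (simp add: f_def)
    have "g \<otimes> f \<otimes> inv g = (g \<otimes> inv g) \<otimes> h \<otimes> (g \<otimes> inv g)"
      unfolding f_def using g hu by (simp add: m_assoc Units_closed del: Units_r_inv)
    then have gf: "g \<otimes> f \<otimes> inv g = h" using g hu by (simp add: Units_closed)
    then have "f \<in> centralizer G S" using h iff[OF f] f by (simp add: mem_centralizer_iff S T)
    then show "h \<in> (\<lambda>f. g \<otimes> f \<otimes> inv g) ` centralizer G S" using gf by blast
  qed
  finally show ?thesis
    using S T g unfolding z_equiv_rel_def conjugate_subsets_def by (auto simp: units_of_carrier)
qed

lemma (in monoid) conjugate_z_equiv: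
  assumes S: "S \<in> carrier G" and g: "g \<in> Units G"
  shows "(S, g \<otimes> S \<otimes> inv g) \<in> z_equiv_rel G"
proof (rule z_equivI[OF S _ g])
  show "g \<otimes> S \<otimes> inv g \<in> carrier G" using S g by (simp add: Units_closed)
  fix f assume f: "f \<in> Units G"
  have can: "inv g \<otimes> (g \<otimes> x) = x" if "x \<in> carrier G" for x
    using that g by (simp add: m_assoc[symmetric] Units_closed)
  have 1: "(g \<otimes> f \<otimes> inv g) \<otimes> (g \<otimes> S \<otimes> inv g) = g \<otimes> (f \<otimes> S) \<otimes> inv g"
    and 2: "(g \<otimes> S \<otimes> inv g) \<otimes> (g \<otimes> f \<otimes> inv g) = g \<otimes> (S \<otimes> f) \<otimes> inv g"
    using S f g by (simp_all add: m_assoc Units_closed can)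
  have "g \<otimes> x \<otimes> inv g = g \<otimes> y \<otimes> inv g \<longleftrightarrow> x = y" if "x \<in> carrier G" "y \<in> carrier G" for x y
  proof
    have *: "inv g \<otimes> (g \<otimes> z \<otimes> inv g) \<otimes> g = z" if "z \<in> carrier G" for z
      using that g by (simp add: m_assoc Units_closed can)
    assume "g \<otimes> x \<otimes> inv g = g \<otimes> y \<otimes> inv g"
    then show "x = y" using * that by metis
  qed simp
  then show "f \<otimes> S = S \<otimes> f \<longleftrightarrow>
      (g \<otimes> f \<otimes> inv g) \<otimes> (g \<otimes> S \<otimes> inv g) = (g \<otimes> S \<otimes> inv g) \<otimes> (g \<otimes> f \<otimes> inv g)"
    unfolding 1 2 using S f by (simp add: Units_closed)
qed

text \<open>
  A finite set that contains the invariants of all affine maps of an \<open>n\<close>-dimensional space.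
\<close>

definition invariants ::
  "nat \<Rightarrow> (nat \<times> (('a::field list ring \<times> ('a \<Rightarrow> 'a list)) set \<times> bool \<times> bool \<times> nat) list
     \<times> (nat \<times> nat) set \<times> nat option) set" where
  "invariants n = {..n} \<times> {xs. set xs \<subseteq> (extensions_le n // extension_iso_rel n) \<times> UNIV \<times> UNIV \<times> {..n} \<and> length xs \<le> n}
     \<times> Pow ({..<n} \<times> {..<n}) \<times> insert None (Some ` {..<n})"

lemma finite_invariants:
  assumes "finitely_many_extensions_le TYPE('a::field) n"
  shows "finite (invariants n :: (nat \<times> (('a list ring \<times> ('a \<Rightarrow> 'a list)) set \<times> bool \<times> bool \<times> nat) list
     \<times> (nat \<times> nat) set \<times> nat option) set)"
  using assms unfolding invariants_def finitely_many_extensions_le_def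
  by (intro finite_cartesian_product finite_lists_length_le) auto

context finite_dimensional_vector_space
begin

lemma normal_form_degree_le:
  assumes nf: "normal_form scale T u r v p k J" and i: "i < r"
  shows "degree (p i) \<le> dim UNIV" "k i \<le> dim UNIV"
proof -
  have p: "irreducible (p i)" "k i > 0" and T: "linear_op scale T"
    and pr: "presents (poly_apply scale T) UNIV r v (\<lambda>i. p i ^ k i)"
    using nf i by (auto simp: normal_form_def)
  have "k i * degree (p i) \<le> dim UNIV"
    using presents_bounds(1)[OF T pr i] p(1) by (subst (asm) degree_power_eq) auto
  moreover have "degree (p i) \<le> k i * degree (p i)" "k i \<le> k i * degree (p i)"
    using p(2) irreducible_degree_pos[OF p(1)] by simp_all
  ultimately show "degree (p i) \<le> dim UNIV" "k i \<le> dim UNIV" by linarith+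
qed

lemma invariant_in_invariants:
  assumes nf: "normal_form scale T u r v p k J"
  shows "invariant (dim UNIV) r p k J \<in> invariants (dim UNIV)"
proof -
  have T: "linear_op scale T" and pr: "presents (poly_apply scale T) UNIV r v (\<lambda>i. p i ^ k i)"
    and p: "\<And>i. i < r \<Longrightarrow> irreducible (p i) \<and> k i > 0"
    using nf by (auto simp: normal_form_def)
  have "degree (p i ^ k i) > 0" if "i < r" for i
    using p[OF that] irreducible_degree_pos[of "p i"] by (subst degree_power_eq) auto
  then have r: "r \<le> dim UNIV" by (rule presents_bounds(2)[OF T pr])
  have "residue_class (dim UNIV) (p i) \<in> extensions_le (dim UNIV) // extension_iso_rel (dim UNIV)" if "i < r" for i
    using residue_class_in_quotient p[OF that] normal_form_degree_le(1)[OF nf that] by blast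
  moreover have "J \<in> insert None (Some ` {..<dim UNIV})"
    using nf r by (auto simp: normal_form_def split: option.splits)
  ultimately show ?thesis
    using r normal_form_degree_le(2)[OF nf] unfolding invariant_def invariants_def by auto
qed

lemma exists_linear_normal_form:
  assumes T: "linear_op scale T"
  shows "\<exists>r v p k. normal_form scale T 0 r v p k None"
proof -
  interpret M: finite_length_module "poly_apply scale T" dim by (rule finite_length_module_poly_apply[OF T])
  show ?thesis using M.exists_primary_presentation[OF M.subspace_UNIV] T unfolding normal_form_def by auto
qed

lemma exists_affine_normal_form:
  assumes T: "linear_op scale T"
  shows "\<exists>o' u r v p k J. s = o' - T o' + u \<and> normal_form scale T u r v p k J"
proof -
  obtain r v p k where "normal_form scale T 0 r v p k None" using exists_linear_normal_form[OF T] by blast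
  then show ?thesis using exists_normal_form[OF T, of r v p k s] unfolding normal_form_def by blast
qed

lemma finite_z_classes_linear:
  assumes fin: "finitely_many_extensions_le TYPE('a) (dim UNIV)"
  shows "finite (z_classes (linear_monoid scale))"
proof -
  interpret M: monoid "linear_monoid scale" by (rule monoid_linear_monoid)
  have mem: "A \<in> carrier (linear_monoid scale) \<longleftrightarrow> linear_op scale A" for A by (simp add: linear_monoid_def)
  have mult: "A \<otimes>\<^bsub>linear_monoid scale\<^esub> B = A \<circ> B" for A B by (simp add: linear_monoid_def)
  have inv: "inv\<^bsub>linear_monoid scale\<^esub> \<phi> = inv_into UNIV \<phi>" if "linear_op scale \<phi>" "bij \<phi>" for \<phi>
  proof (rule M.inv_char)
    show "\<phi> \<in> carrier (linear_monoid scale)" "inv_into UNIV \<phi> \<in> carrier (linear_monoid scale)"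
      using that linear_inv by (simp_all add: mem)
    show "\<phi> \<otimes>\<^bsub>linear_monoid scale\<^esub> inv_into UNIV \<phi> = \<one>\<^bsub>linear_monoid scale\<^esub>"
      "inv_into UNIV \<phi> \<otimes>\<^bsub>linear_monoid scale\<^esub> \<phi> = \<one>\<^bsub>linear_monoid scale\<^esub>"
      using that(2) by (auto simp: linear_monoid_def fun_eq_iff bij_is_inj bij_is_surj surj_f_inv_f)
  qed
  have comm: "B \<circ> T = T \<circ> B \<longleftrightarrow> commutes B 0 T 0" if "linear_op scale B" "linear_op scale T" for B T
    using that by (auto simp: commutes_def fun_eq_iff linear_opD(3))
  show ?thesis
    unfolding z_classes_def
  proof (rule finite_quotient_by_invariant[OF M.equiv_z_equiv_rel finite_invariants[OF fin]])
    let ?P = "\<lambda>T i. \<exists>r v p k. normal_form scale T 0 r v p k None \<and> i = invariant (dim UNIV) r p k None"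
    fix T assume "T \<in> carrier (linear_monoid scale)"
    then have "linear_op scale T" by (simp add: mem)
    from exists_linear_normal_form[OF this] show "\<exists>i\<in>invariants (dim UNIV). ?P T i"
      using invariant_in_invariants by blast
    fix T' i assume "T' \<in> carrier (linear_monoid scale)" "?P T i" "?P T' i"
    then obtain r v p k r' v' p' k' where
      nf: "normal_form scale T 0 r v p k None" and nf': "normal_form scale T' 0 r' v' p' k' None" and
      eq: "invariant (dim UNIV) r p k None = invariant (dim UNIV) r' p' k' None" by auto
    have T: "linear_op scale T" "linear_op scale T'" using nf nf' by (auto simp: normal_form_def)
    obtain \<phi> where \<phi>: "linear_op scale \<phi>" "bij \<phi>" and *: "\<And>B. linear_op scale B \<Longrightarrow>
        commutes B 0 T 0 \<longleftrightarrow> commutes (\<phi> \<circ> B \<circ> inv_into UNIV \<phi>) (\<phi> 0) T' 0"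
      using same_invariant_imp_same_commutation[OF nf nf' normal_form_degree_le(1)[OF nf] eq] by metis
    show "(T, T') \<in> z_equiv_rel (linear_monoid scale)"
    proof (rule M.z_equivI)
      show "T \<in> carrier (linear_monoid scale)" "T' \<in> carrier (linear_monoid scale)" using T by (simp_all add: mem)
      show "\<phi> \<in> Units (linear_monoid scale)" using \<phi> by (simp add: Units_linear_monoid)
      fix B assume "B \<in> Units (linear_monoid scale)"
      then have B: "linear_op scale B" by (simp add: Units_linear_monoid)
      have "linear_op scale (\<phi> \<circ> B \<circ> inv_into UNIV \<phi>)"
        using Vector_Spaces.linear_compose[OF linear_inv[OF \<phi>] Vector_Spaces.linear_compose[OF B \<phi>(1)]] .
      then show "B \<otimes>\<^bsub>linear_monoid scale\<^esub> T = T \<otimes>\<^bsub>linear_monoid scale\<^esub> B \<longleftrightarrow>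
          \<phi> \<otimes>\<^bsub>linear_monoid scale\<^esub> B \<otimes>\<^bsub>linear_monoid scale\<^esub> inv\<^bsub>linear_monoid scale\<^esub> \<phi> \<otimes>\<^bsub>linear_monoid scale\<^esub> T' =
          T' \<otimes>\<^bsub>linear_monoid scale\<^esub> (\<phi> \<otimes>\<^bsub>linear_monoid scale\<^esub> B \<otimes>\<^bsub>linear_monoid scale\<^esub> inv\<^bsub>linear_monoid scale\<^esub> \<phi>)"
        unfolding inv[OF \<phi>] mult using *[OF B] comm B T linear_opD(3)[OF \<phi>(1)] by simp
    qed
  qed
qed

lemma finite_z_classes_affine:
  assumes fin: "finitely_many_extensions_le TYPE('a) (dim UNIV)"
  shows "finite (z_classes (affine_monoid scale))"
proof -
  let ?G = "affine_monoid scale"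
  interpret M: monoid ?G by (rule monoid_affine_monoid)
  have mult: "A \<otimes>\<^bsub>?G\<^esub> B = A \<circ> B" for A B by (simp add: affine_monoid_def)
  have one: "\<one>\<^bsub>?G\<^esub> = id" by (simp add: affine_monoid_def)
  have units: "(\<lambda>x. A x + v) \<in> Units ?G" if "linear_op scale A" "bij A" for A v
    using that unfolding Units_affine_monoid by blast
  have lunits: "A \<in> Units ?G" if "linear_op scale A" "bij A" for A
    using units[OF that, of 0] by simp
  have inv: "inv\<^bsub>?G\<^esub> \<phi> = inv_into UNIV \<phi>" if "linear_op scale \<phi>" "bij \<phi>" for \<phi>
  proof (rule M.inv_char)
    show "\<phi> \<in> carrier ?G" using lunits[OF that] by (rule M.Units_closed)
    show "inv_into UNIV \<phi> \<in> carrier ?G"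
      using lunits[OF linear_inv[OF that] bij_imp_bij_inv[OF that(2)]] by (rule M.Units_closed)
    show "\<phi> \<otimes>\<^bsub>?G\<^esub> inv_into UNIV \<phi> = \<one>\<^bsub>?G\<^esub>" "inv_into UNIV \<phi> \<otimes>\<^bsub>?G\<^esub> \<phi> = \<one>\<^bsub>?G\<^esub>"
      using that(2) by (auto simp: mult one fun_eq_iff bij_is_inj bij_is_surj surj_f_inv_f)
  qed
  \<comment> \<open>Moving the origin is conjugation by a translation.\<close>
  have trans: "(\<lambda>x. T x + u, \<lambda>x. T x + (o' - T o' + u)) \<in> z_equiv_rel ?G" if T: "linear_op scale T" for T u o'
  proof -
    let ?t = "\<lambda>x. id x + o'"
    have t: "?t \<in> Units ?G" by (rule units[OF linear_id bij_id])
    have t': "(\<lambda>x. id x + - o') \<in> Units ?G" by (rule units[OF linear_id bij_id])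
    have "inv\<^bsub>?G\<^esub> ?t = (\<lambda>x. id x + - o')"
      by (rule M.inv_char[OF M.Units_closed[OF t] M.Units_closed[OF t']]) (auto simp: mult one)
    then have "?t \<otimes>\<^bsub>?G\<^esub> (\<lambda>x. T x + u) \<otimes>\<^bsub>?G\<^esub> inv\<^bsub>?G\<^esub> ?t = (\<lambda>x. T x + (o' - T o' + u))"
      by (simp only: mult) (auto simp: linear_opD(5)[OF T] algebra_simps)
    then show ?thesis using M.conjugate_z_equiv[OF affine_monoid_memI[OF T] t, of u] by (simp only:)
  qed
  have core: "(\<lambda>x. T x + u, \<lambda>x. T' x + u') \<in> z_equiv_rel ?G"
    if nf: "normal_form scale T u r v p k J" and nf': "normal_form scale T' u' r' v' p' k' J'"
      and eq: "invariant (dim UNIV) r p k J = invariant (dim UNIV) r' p' k' J'" for T u r v p k J T' u' r' v' p' k' J'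
  proof -
    have T: "linear_op scale T" "linear_op scale T'" using nf nf' by (auto simp: normal_form_def)
    obtain \<phi> where \<phi>: "linear_op scale \<phi>" "bij \<phi>" and *: "\<And>B w. linear_op scale B \<Longrightarrow>
        commutes B w T u \<longleftrightarrow> commutes (\<phi> \<circ> B \<circ> inv_into UNIV \<phi>) (\<phi> w) T' u'"
      using same_invariant_imp_same_commutation[OF nf nf' normal_form_degree_le(1)[OF nf] eq] by metis
    show ?thesis
    proof (rule M.z_equivI[OF affine_monoid_memI[OF T(1)] affine_monoid_memI[OF T(2)] lunits[OF \<phi>]])
      fix f assume "f \<in> Units ?G"
      then obtain B w where B: "f = (\<lambda>x. B x + w)" "linear_op scale B" unfolding Units_affine_monoid by blast
      have lin: "linear_op scale (\<phi> \<circ> B \<circ> inv_into UNIV \<phi>)"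
        using Vector_Spaces.linear_compose[OF linear_inv[OF \<phi>] Vector_Spaces.linear_compose[OF B(2) \<phi>(1)]] .
      have conj: "\<phi> \<circ> f \<circ> inv_into UNIV \<phi> = (\<lambda>x. (\<phi> \<circ> B \<circ> inv_into UNIV \<phi>) x + \<phi> w)"
        by (auto simp: B(1) linear_opD(1)[OF \<phi>(1)])
      show "f \<otimes>\<^bsub>?G\<^esub> (\<lambda>x. T x + u) = (\<lambda>x. T x + u) \<otimes>\<^bsub>?G\<^esub> f \<longleftrightarrow>
          \<phi> \<otimes>\<^bsub>?G\<^esub> f \<otimes>\<^bsub>?G\<^esub> inv\<^bsub>?G\<^esub> \<phi> \<otimes>\<^bsub>?G\<^esub> (\<lambda>x. T' x + u') =
          (\<lambda>x. T' x + u') \<otimes>\<^bsub>?G\<^esub> (\<phi> \<otimes>\<^bsub>?G\<^esub> f \<otimes>\<^bsub>?G\<^esub> inv\<^bsub>?G\<^esub> \<phi>)"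
        unfolding inv[OF \<phi>] mult conj affine_commute_iff[OF lin T(2)]
        unfolding B(1) affine_commute_iff[OF B(2) T(1)] by (rule *[OF B(2)])
    qed
  qed
  note eqv = M.equiv_z_equiv_rel
  show ?thesis
    unfolding z_classes_def
  proof (rule finite_quotient_by_invariant[OF eqv finite_invariants[OF fin]])
    let ?P = "\<lambda>F i. \<exists>T u o' r v p k J. F = (\<lambda>x. T x + (o' - T o' + u))
      \<and> normal_form scale T u r v p k J \<and> i = invariant (dim UNIV) r p k J"
    fix F assume "F \<in> carrier ?G"
    then obtain T s where F: "F = (\<lambda>x. T x + s)" "linear_op scale T" by (auto simp: affine_monoid_def)
    obtain o' u r v p k J where "s = o' - T o' + u" "normal_form scale T u r v p k J"
      using exists_affine_normal_form[OF F(2), of s] by blast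
    then show "\<exists>i\<in>invariants (dim UNIV). ?P F i"
      using invariant_in_invariants unfolding F(1) by blast
  next
    let ?P = "\<lambda>F i. \<exists>T u o' r v p k J. F = (\<lambda>x. T x + (o' - T o' + u))
      \<and> normal_form scale T u r v p k J \<and> i = invariant (dim UNIV) r p k J"
    fix F F' i assume "?P F i" "?P F' i"
    then obtain T u o1 r v p k J T' u' o2 r' v' p' k' J' where
      F: "F = (\<lambda>x. T x + (o1 - T o1 + u))" "F' = (\<lambda>x. T' x + (o2 - T' o2 + u'))" and
      nf: "normal_form scale T u r v p k J" and nf': "normal_form scale T' u' r' v' p' k' J'" and
      eq: "invariant (dim UNIV) r p k J = invariant (dim UNIV) r' p' k' J'" by auto
    have T: "linear_op scale T" "linear_op scale T'" using nf nf' by (auto simp: normal_form_def)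
    have "(F, \<lambda>x. T x + u) \<in> z_equiv_rel ?G"
      unfolding F by (rule symD[OF _ trans[OF T(1)]]) (use eqv in \<open>simp add: equiv_def\<close>)
    moreover have "(\<lambda>x. T' x + u', F') \<in> z_equiv_rel ?G" unfolding F by (rule trans[OF T(2)])
    moreover have "Relation.trans (z_equiv_rel ?G)" using eqv by (simp add: equiv_def)
    ultimately show "(F, F') \<in> z_equiv_rel ?G" using core[OF nf nf' eq] by (meson transD)
  qed
qed

end

theorem theorem7p4:
  fixes scale :: "'a::field \<Rightarrow> 'v::ab_group_add \<Rightarrow> 'v"
    and Basis :: "'v set" and n :: nat
  assumes "finite_dimensional_vector_space scale Basis"
    and "vector_space.dim scale (UNIV :: 'v set) = n"
    and "finitely_many_extensions_le TYPE('a) n"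
  shows "finite (z_classes (linear_monoid scale)) \<and> finite (z_classes (affine_monoid scale))"
proof -
  interpret finite_dimensional_vector_space scale Basis by (rule assms(1))
  show ?thesis
    using finite_z_classes_linear finite_z_classes_affine assms(2,3) by simp
qed

end
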